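(* Let $k$ be a field (of arbitrary characteristic), let $n$ be a positive integer, and let $G$ be a subgroup of $\mathfrak{S}_n$ acting naturally on $A=k_{-1}[x_1,\dots,x_n]$ by permuting the variables. Suppose that $\operatorname{char} k$ does not divide $|G|$. Then $$d_{A^G}\le \tfrac12 n(n-1)+\left\lfloor \tfrac n2\right\rfloor\left(\left\lfloor \tfrac n2\right\rfloor+1\right)\sim \tfrac34 n^2,$$ where $\sim$ means that the bound is asymptotic to $\tfrac34 n^2$ as $n\to\infty$.
   Context: $k_{-1}[x_1,\dots,x_n]$ is the $k$-algebra generated by $x_1,\dots,x_n$ subject to $x_ix_j=-x_jx_i$ for all $i\ne j$, graded by $\deg x_i=1$. The symmetric group $\mathfrak{S}_n$ acts on it by the graded algebra automorphisms $x_i\mapsto x_{\sigma(i)}$, and $A^G$ is the fixed subring. For a connected graded algebra $B=k\oplus B_1\oplus B_2\oplus\cdots$, with $B_{\ge1}=\bigoplus_{i\ge1}B_i$, the number $d_B$ is the maximal degree of the graded vector space $B_{\ge 1}/(B_{\ge 1})^2$; thus $B$ is generated as an algebra by homogeneous elements of degree at most $d_B$. The condition that $\operatorname{char}k$ does not divide $|G|$ is automatically satisfied in characteristic $0$.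
   Formalization: The formal theorem assumes n ≥ 2 instead of n positive: for n = 1 the group is trivial, A^G = k[x_1] has d = 1, while the stated bound is 0, so the claim fails exactly in that case. *)

theory Defs
  imports "HOL-Library.Poly_Mapping" "HOL-Library.Extended_Nat" "HOL-Library.Landau_Symbols"
    "HOL-Algebra.Sym_Groups" "HOL-Algebra.QuotRing" "HOL-Algebra.Ideal_Product"
begin

section \<open>The free algebra\<close>

text \<open>
  Words are written additively, so that the convolution product of \<open>HOL-Library.Poly_Mapping\<close>
  turns the finitely supported functions on words into the free associative algebra.
\<close>

datatype 'a free_monoid = Word (letters: "'a list")

instantiation free_monoid :: (type) monoid_add
begin

definition zero_free_monoid :: "'a free_monoid"
  where "0 = Word []"

definition plus_free_monoid :: "'a free_monoid \<Rightarrow> 'a free_monoid \<Rightarrow> 'a free_monoid"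
  where "v + w = Word (letters v @ letters w)"

instance
  by standard (simp_all add: zero_free_monoid_def plus_free_monoid_def)

end

type_synonym 'k nc_poly = "nat free_monoid \<Rightarrow>\<^sub>0 'k"

definition free_algebra :: "nat \<Rightarrow> 'k::field nc_poly ring"
  where "free_algebra n =
    \<lparr>carrier = {f. \<forall>w\<in>Poly_Mapping.keys f. set (letters w) \<subseteq> {1..n}},
     mult = (*), one = 1, zero = 0, add = (+)\<rparr>"

definition gen_var :: "nat \<Rightarrow> 'k::field nc_poly"
  where "gen_var i = Poly_Mapping.single (Word [i]) 1"

definition homogeneous :: "nat \<Rightarrow> 'k::field nc_poly \<Rightarrow> bool"
  where "homogeneous d f \<longleftrightarrow> (\<forall>w\<in>Poly_Mapping.keys f. length (letters w) = d)"

text \<open>The algebra endomorphism of the free algebra with \<open>x\<^sub>i \<mapsto> x\<^bsub>\<sigma>(i)\<^esub>\<close>.\<close>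

definition rename_vars :: "(nat \<Rightarrow> nat) \<Rightarrow> 'k::field nc_poly \<Rightarrow> 'k nc_poly"
  where "rename_vars \<sigma> f =
    (\<Sum>w\<in>Poly_Mapping.keys f.
      Poly_Mapping.single (map_free_monoid \<sigma> w) (Poly_Mapping.lookup f w))"


lemma free_algebra_simps:
  "f \<otimes>\<^bsub>free_algebra n\<^esub> g = f * g" "f \<oplus>\<^bsub>free_algebra n\<^esub> g = f + g"
  "\<one>\<^bsub>free_algebra n\<^esub> = 1" "\<zero>\<^bsub>free_algebra n\<^esub> = 0"
  by (simp_all add: free_algebra_def)

lemma ring_free_algebra: "ring (free_algebra n :: 'k::field nc_poly ring)"
proof (rule ringI)
  show "abelian_group (free_algebra n :: 'k nc_poly ring)"
  proof (rule abelian_groupI)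
    fix f g :: "'k nc_poly"
    assume f: "f \<in> carrier (free_algebra n)" and g: "g \<in> carrier (free_algebra n)"
    show "f \<oplus>\<^bsub>free_algebra n\<^esub> g \<in> carrier (free_algebra n)"
      using f g Poly_Mapping.keys_add[of f g] by (auto simp: free_algebra_def)
    show "\<exists>y\<in>carrier (free_algebra n). y \<oplus>\<^bsub>free_algebra n\<^esub> f = \<zero>\<^bsub>free_algebra n\<^esub>"
      using f by (intro bexI[of _ "- f"]) (auto simp: free_algebra_def)
  qed (auto simp: free_algebra_def algebra_simps)
  show "monoid (free_algebra n :: 'k nc_poly ring)"
  proof (rule monoidI)
    fix f g :: "'k nc_poly"
    assume "f \<in> carrier (free_algebra n)" "g \<in> carrier (free_algebra n)"
    then show "f \<otimes>\<^bsub>free_algebra n\<^esub> g \<in> carrier (free_algebra n)"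
      using Poly_Mapping.keys_mult[of f g]
      by (fastforce simp: free_algebra_def plus_free_monoid_def)
  qed (auto simp: free_algebra_def algebra_simps zero_free_monoid_def)
qed (auto simp: free_algebra_def algebra_simps)

lemma rename_vars_alt:
  assumes "finite W" "Poly_Mapping.keys f \<subseteq> W"
  shows "rename_vars \<sigma> f =
    (\<Sum>w\<in>W. Poly_Mapping.single (map_free_monoid \<sigma> w) (Poly_Mapping.lookup f w))"
  unfolding rename_vars_def using assms
  by (intro sum.mono_neutral_left) (auto simp: in_keys_iff)

lemma rename_vars_zero [simp]: "rename_vars \<sigma> 0 = 0"
  by (simp add: rename_vars_def)

lemma rename_vars_single [simp]:
  "rename_vars \<sigma> (Poly_Mapping.single w c) = Poly_Mapping.single (map_free_monoid \<sigma> w) c"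
  by (simp add: rename_vars_def)

lemma rename_vars_gen_var: "rename_vars \<sigma> (gen_var i) = gen_var (\<sigma> i)"
  by (simp add: gen_var_def)

lemma rename_vars_add: "rename_vars \<sigma> (f + g) = rename_vars \<sigma> f + rename_vars \<sigma> g"
proof -
  let ?W = "Poly_Mapping.keys f \<union> Poly_Mapping.keys g"
  have "Poly_Mapping.keys (f + g) \<subseteq> ?W"
    by (rule Poly_Mapping.keys_add)
  then show ?thesis
    by (simp add: rename_vars_alt[of ?W] lookup_add single_add sum.distrib)
qed

lemma rename_vars_sum: "rename_vars \<sigma> (sum f I) = (\<Sum>i\<in>I. rename_vars \<sigma> (f i))"
  by (induction I rule: infinite_finite_induct) (auto simp: rename_vars_add)

lemma nc_poly_sum_singles:
  "f = (\<Sum>w\<in>Poly_Mapping.keys f. Poly_Mapping.single w (Poly_Mapping.lookup f w))"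
  by (rule poly_mapping_eqI)
    (auto simp: lookup_sum lookup_single when_def in_keys_iff sum.delta)

lemma rename_vars_mult: "rename_vars \<sigma> (f * g) = rename_vars \<sigma> f * rename_vars \<sigma> g"
proof -
  have map: "map_free_monoid \<sigma> (v + w) = map_free_monoid \<sigma> v + map_free_monoid \<sigma> w" for v w
    by (cases v; cases w) (simp add: plus_free_monoid_def)
  have "rename_vars \<sigma> (f * g) = rename_vars \<sigma>
    ((\<Sum>v\<in>Poly_Mapping.keys f. Poly_Mapping.single v (Poly_Mapping.lookup f v)) *
     (\<Sum>w\<in>Poly_Mapping.keys g. Poly_Mapping.single w (Poly_Mapping.lookup g w)))"
    using nc_poly_sum_singles[of f] nc_poly_sum_singles[of g] by simp
  also have "\<dots> = rename_vars \<sigma> f * rename_vars \<sigma> g"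
    by (simp add: rename_vars_sum sum_product mult_single map)
      (simp add: rename_vars_def sum_product mult_single)
  finally show ?thesis .
qed

lemma rename_vars_one: "rename_vars \<sigma> (1 :: 'k::field nc_poly) = 1"
proof -
  have "(1 :: 'k nc_poly) = Poly_Mapping.single 0 1" by simp
  then show ?thesis
    by (metis free_monoid.map list.simps(8) rename_vars_single zero_free_monoid_def)
qed

lemma rename_vars_comp: "rename_vars \<sigma> (rename_vars \<tau> f) = rename_vars (\<sigma> \<circ> \<tau>) f"
proof -
  have "rename_vars \<sigma> (rename_vars \<tau> f) = (\<Sum>w\<in>Poly_Mapping.keys f. rename_vars \<sigma>
    (Poly_Mapping.single (map_free_monoid \<tau> w) (Poly_Mapping.lookup f w)))"
    by (simp add: rename_vars_def[of \<tau>] rename_vars_sum)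
  then show ?thesis
    by (simp add: rename_vars_def[of "\<sigma> \<circ> \<tau>"] free_monoid.map_comp)
qed

lemma rename_vars_id [simp]: "rename_vars id f = f"
  unfolding rename_vars_def by (simp add: free_monoid.map_id nc_poly_sum_singles[symmetric])

lemma rename_vars_carrier:
  assumes "\<sigma> permutes {1..n}" "f \<in> carrier (free_algebra n)"
  shows "rename_vars \<sigma> f \<in> carrier (free_algebra n)"
proof -
  have "Poly_Mapping.keys (rename_vars \<sigma> f) \<subseteq> map_free_monoid \<sigma> ` Poly_Mapping.keys f"
    unfolding rename_vars_def
    by (rule order_trans[OF Poly_Mapping.keys_sum]) auto
  moreover have "set (letters (map_free_monoid \<sigma> w)) \<subseteq> {1..n}"
    if "w \<in> Poly_Mapping.keys f" for w
    using assms(2) that permutes_image[OF assms(1)]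
    by (cases w) (fastforce simp: free_algebra_def)
  ultimately show ?thesis
    by (auto simp: free_algebra_def)
qed

section \<open>The skew polynomial algebra \<open>k\<^bsub>-1\<^esub>[x\<^sub>1,\<dots>,x\<^sub>n]\<close>\<close>

definition skew_relations :: "nat \<Rightarrow> 'k::field nc_poly set"
  where "skew_relations n =
    {gen_var i * gen_var j + gen_var j * gen_var i | i j. i \<in> {1..n} \<and> j \<in> {1..n} \<and> i \<noteq> j}"

definition skew_ideal :: "nat \<Rightarrow> 'k::field nc_poly set"
  where "skew_ideal n = Idl\<^bsub>free_algebra n\<^esub> (skew_relations n)"

definition skew_poly_ring :: "nat \<Rightarrow> 'k::field nc_poly set ring"
  where "skew_poly_ring n = free_algebra n Quot skew_ideal n"

definition skew_class :: "nat \<Rightarrow> 'k::field nc_poly \<Rightarrow> 'k nc_poly set"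
  where "skew_class n f = skew_ideal n +>\<^bsub>free_algebra n\<^esub> f"

lemma skew_relations_carrier: "skew_relations n \<subseteq> carrier (free_algebra n)"
proof -
  interpret ring "free_algebra n" by (rule ring_free_algebra)
  have "gen_var i \<in> carrier (free_algebra n)" if "i \<in> {1..n}" for i
    using that by (simp add: free_algebra_def gen_var_def)
  then show ?thesis
    using a_closed m_closed unfolding skew_relations_def free_algebra_simps by blast
qed

lemma ideal_skew_ideal: "ideal (skew_ideal n) (free_algebra n)"
  unfolding skew_ideal_def
  by (rule ring.genideal_ideal[OF ring_free_algebra skew_relations_carrier])

lemma ring_skew_poly_ring: "ring (skew_poly_ring n)"
  unfolding skew_poly_ring_def by (rule ideal.quotient_is_ring[OF ideal_skew_ideal])

lemma skew_class_hom: "skew_class n \<in> ring_hom (free_algebra n) (skew_poly_ring n)"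
  unfolding skew_poly_ring_def skew_class_def[abs_def]
  by (rule ideal.rcos_ring_hom[OF ideal_skew_ideal])

lemma skew_class_surj: "skew_class n ` carrier (free_algebra n) = carrier (skew_poly_ring n)"
  by (auto simp: skew_poly_ring_def FactRing_def A_RCOSETS_def' skew_class_def a_r_coset_def')

definition skew_component :: "nat \<Rightarrow> nat \<Rightarrow> 'k::field nc_poly set set"
  where "skew_component n d = skew_class n ` {f \<in> carrier (free_algebra n). homogeneous d f}"

text \<open>
  A permutation acts on a residue class elementwise; by \<open>perm_act_class\<close> below this is the
  automorphism of the quotient induced by \<^const>\<open>rename_vars\<close>.
\<close>

definition perm_act :: "(nat \<Rightarrow> nat) \<Rightarrow> 'k::field nc_poly set \<Rightarrow> 'k nc_poly set"
  where "perm_act \<sigma> U = rename_vars \<sigma> ` U"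

lemma rename_vars_skew_ideal_subset:
  assumes "\<sigma> permutes {1..n}"
  shows "rename_vars \<sigma> ` skew_ideal n \<subseteq> (skew_ideal n :: 'k::field nc_poly set)"
proof -
  let ?F = "free_algebra n :: 'k nc_poly ring"
  interpret F: ring ?F by (rule ring_free_algebra)
  interpret I: ideal "skew_ideal n" ?F by (rule ideal_skew_ideal)
  have "rename_vars \<sigma> \<in> ring_hom ?F ?F"
    using assms by (intro ring_hom_memI)
      (auto simp: free_algebra_simps rename_vars_add rename_vars_mult rename_vars_one
        rename_vars_carrier)
  then have "skew_class n \<circ> rename_vars \<sigma> \<in> ring_hom ?F (skew_poly_ring n)"
    using skew_class_hom by (rule ring_hom_trans)
  then interpret h: ring_hom_ring ?F "skew_poly_ring n" "skew_class n \<circ> rename_vars \<sigma>"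
    by (intro ring_hom_ringI2 F.ring_axioms ring_skew_poly_ring)
  let ?J = "a_kernel ?F (skew_poly_ring n) (skew_class n \<circ> rename_vars \<sigma>)"
  have J: "f \<in> ?J \<longleftrightarrow> f \<in> carrier ?F \<and> rename_vars \<sigma> f \<in> skew_ideal n" for f
  proof -
    have "f \<in> ?J \<longleftrightarrow> f \<in> carrier ?F \<and> skew_class n (rename_vars \<sigma> f) = skew_ideal n"
      by (simp add: a_kernel_def' skew_poly_ring_def FactRing_def)
    then show ?thesis
      using I.a_rcos_const I.rcos_const_imp_mem rename_vars_carrier[OF assms, of f]
      unfolding skew_class_def by blast
  qed
  have "skew_relations n \<subseteq> ?J"
  proof
    fix f :: "'k nc_poly" assume f: "f \<in> skew_relations n"
    then have "rename_vars \<sigma> f \<in> skew_relations n"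
      using permutes_in_image[OF assms] permutes_inj[OF assms]
      by (fastforce simp: skew_relations_def rename_vars_add rename_vars_mult rename_vars_gen_var
        inj_eq)
    moreover have "skew_relations n \<subseteq> (skew_ideal n :: 'k nc_poly set)"
      unfolding skew_ideal_def by (rule F.genideal_self[OF skew_relations_carrier])
    ultimately show "f \<in> ?J"
      using f skew_relations_carrier J by blast
  qed
  then have "skew_ideal n \<subseteq> ?J"
    unfolding skew_ideal_def by (rule F.genideal_minimal[OF h.kernel_is_ideal])
  then have "rename_vars \<sigma> ` skew_ideal n \<subseteq> (skew_ideal n :: 'k nc_poly set)"
    using J by blast
  then show ?thesis .
qed

lemma rename_vars_skew_ideal:
  assumes "\<sigma> permutes {1..n}"
  shows "rename_vars \<sigma> ` skew_ideal n = (skew_ideal n :: 'k::field nc_poly set)"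
proof
  show "rename_vars \<sigma> ` skew_ideal n \<subseteq> (skew_ideal n :: 'k nc_poly set)"
    by (rule rename_vars_skew_ideal_subset[OF assms])
  show "(skew_ideal n :: 'k nc_poly set) \<subseteq> rename_vars \<sigma> ` skew_ideal n"
  proof
    fix f :: "'k nc_poly" assume "f \<in> skew_ideal n"
    then have "rename_vars (inv_into UNIV \<sigma>) f \<in> skew_ideal n"
      using rename_vars_skew_ideal_subset[OF permutes_inv[OF assms]] by blast
    moreover have "f = rename_vars \<sigma> (rename_vars (inv_into UNIV \<sigma>) f)"
      by (simp add: rename_vars_comp permutes_inv_o[OF assms])
    ultimately show "f \<in> rename_vars \<sigma> ` skew_ideal n" by blast
  qed
qed

lemma perm_act_class:
  assumes "\<sigma> permutes {1..n}"
  shows "perm_act \<sigma> (skew_class n f) = skew_class n (rename_vars \<sigma> f)"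
proof -
  have "perm_act \<sigma> (skew_class n f) = (\<lambda>g. g + rename_vars \<sigma> f) ` (rename_vars \<sigma> ` skew_ideal n)"
    by (simp add: perm_act_def skew_class_def a_r_coset_def' free_algebra_simps image_UN
      UNION_singleton_eq_range image_image rename_vars_add)
  also have "\<dots> = skew_class n (rename_vars \<sigma> f)"
    by (auto simp: rename_vars_skew_ideal[OF assms] skew_class_def a_r_coset_def'
      free_algebra_simps)
  finally show ?thesis .
qed

lemma perm_act_hom:
  assumes "\<sigma> permutes {1..n}"
  shows "perm_act \<sigma> \<in> ring_hom (skew_poly_ring n :: 'k::field nc_poly set ring) (skew_poly_ring n)"
proof (rule ring_hom_memI)
  fix U V :: "'k nc_poly set"
  assume UV: "U \<in> carrier (skew_poly_ring n)" "V \<in> carrier (skew_poly_ring n)"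
  then obtain f g where f: "f \<in> carrier (free_algebra n)" "U = skew_class n f"
    and g: "g \<in> carrier (free_algebra n)" "V = skew_class n g"
    using UV[folded skew_class_surj] by (elim imageE) blast
  note fg = rename_vars_carrier[OF assms f(1)] rename_vars_carrier[OF assms g(1)]
  show "perm_act \<sigma> U \<in> carrier (skew_poly_ring n)"
    unfolding f(2) perm_act_class[OF assms] using fg(1) skew_class_surj by blast
  note h = ring_hom_mult[OF skew_class_hom, unfolded free_algebra_simps, symmetric]
    ring_hom_add[OF skew_class_hom, unfolded free_algebra_simps, symmetric]
  show "perm_act \<sigma> (U \<otimes>\<^bsub>skew_poly_ring n\<^esub> V) =
      perm_act \<sigma> U \<otimes>\<^bsub>skew_poly_ring n\<^esub> perm_act \<sigma> V"
    unfolding f(2) g(2) h(1)[OF f(1) g(1)] perm_act_class[OF assms] rename_vars_mult h(1)[OF fg] ..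
  show "perm_act \<sigma> (U \<oplus>\<^bsub>skew_poly_ring n\<^esub> V) =
      perm_act \<sigma> U \<oplus>\<^bsub>skew_poly_ring n\<^esub> perm_act \<sigma> V"
    unfolding f(2) g(2) h(2)[OF f(1) g(1)] perm_act_class[OF assms] rename_vars_add h(2)[OF fg] ..
next
  have "\<one>\<^bsub>skew_poly_ring n\<^esub> = skew_class n (1 :: 'k nc_poly)"
    by (rule ring_hom_one[OF skew_class_hom, unfolded free_algebra_simps, symmetric])
  then show "perm_act \<sigma> \<one>\<^bsub>skew_poly_ring n\<^esub> = (\<one>\<^bsub>skew_poly_ring n\<^esub> :: 'k nc_poly set)"
    by (simp add: perm_act_class[OF assms] rename_vars_one)
qed

definition invariant_ring :: "nat \<Rightarrow> (nat \<Rightarrow> nat) set \<Rightarrow> 'k::field nc_poly set ring"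
  where "invariant_ring n G = (skew_poly_ring n)
    \<lparr>carrier := {U \<in> carrier (skew_poly_ring n). \<forall>\<sigma>\<in>G. perm_act \<sigma> U = U}\<rparr>"

definition invariant_component :: "nat \<Rightarrow> (nat \<Rightarrow> nat) set \<Rightarrow> nat \<Rightarrow> 'k::field nc_poly set set"
  where "invariant_component n G d = skew_component n d \<inter> carrier (invariant_ring n G)"


section \<open>The number \<open>d\<^sub>B\<close> of a connected graded algebra\<close>

text \<open>
  The algebra \<open>B\<close> is given with its homogeneous components \<open>\<B> d\<close>. As these are closed under
  scalars, the additive subgroups below are subspaces.
\<close>

definition irrelevant_ideal :: "('a, 'b) ring_scheme \<Rightarrow> (nat \<Rightarrow> 'a set) \<Rightarrow> 'a set"
  where "irrelevant_ideal B \<B> = generate (add_monoid B) (\<Union>d\<in>{1..}. \<B> d)"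

definition irrelevant_square :: "('a, 'b) ring_scheme \<Rightarrow> (nat \<Rightarrow> 'a set) \<Rightarrow> 'a set"
  where "irrelevant_square B \<B> = ideal_prod B (irrelevant_ideal B \<B>) (irrelevant_ideal B \<B>)"

text \<open>The degree \<open>d\<close> part (for \<open>d \<ge> 1\<close>) of \<open>B\<^bsub>\<ge>1\<^esub> / (B\<^bsub>\<ge>1\<^esub>)\<^sup>2\<close>.\<close>

definition indecomposables :: "('a, 'b) ring_scheme \<Rightarrow> (nat \<Rightarrow> 'a set) \<Rightarrow> nat \<Rightarrow> 'a set set"
  where "indecomposables B \<B> d = (\<lambda>b. irrelevant_square B \<B> +>\<^bsub>B\<^esub> b) ` \<B> d"

text \<open>
  The zero element of the quotient space is the coset \<open>irrelevant_square B \<B>\<close>. The supremum is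
  taken in \<^typ>\<open>enat\<close>, so it is infinite if the degrees are unbounded.
\<close>

definition max_generator_degree :: "('a, 'b) ring_scheme \<Rightarrow> (nat \<Rightarrow> 'a set) \<Rightarrow> enat"
  where "max_generator_degree B \<B> =
    Sup (enat ` {d. d \<ge> 1 \<and> indecomposables B \<B> d \<noteq> {irrelevant_square B \<B>}})"

end

theory Submission
  imports Defs "HOL-Algebra.Subrings" "HOL-Real_Asymp.Real_Asymp"
begin

text \<open>
  Put \<open>y\<^sub>i = x\<^sub>i\<^sup>2\<close>, a central element. Up to signs, the elements
  \<open>e\<^sub>k = \<Sum>\<^bsub>|S|=k\<^esub> \<Prod>\<^bsub>i\<in>S\<^esub> y\<^sub>i\<close> and
  \<open>E\<^sub>k = \<Sum>\<^bsub>|S|=k, s\<notin>S\<^esub> (\<Prod>\<^bsub>i\<in>S\<^esub> y\<^sub>i) x\<^sub>s\<close> are invariant under the full symmetric group, so the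
  average over \<open>G\<close> of \<open>E\<^sub>k b\<close> or \<open>e\<^sub>k b\<close>, for a monomial \<open>b\<close> of positive degree, is decomposable.
  As in Goebel's theorem, such a product has the leading term \<open>x\<^sup>a\<close> when the exponents \<open>a\<close>,
  sorted decreasingly, have large gaps in the right places; here leading means of maximal
  \<open>\<Sum> a\<^sub>i\<^sup>2\<close>, which is strict by the rearrangement inequality. Hence \<open>x\<^sup>a\<close> is decomposable modulo
  smaller monomials unless all gaps are at most \<open>2\<close> and no two consecutive gaps equal \<open>2\<close>.
  If \<open>2\<close> is invertible, the gap pattern \<open>2, 1, 2\<close> is excluded as well, and the remaining exponent
  vectors have degree within the bound, apart from a few monomials for \<open>n \<le> 3\<close>. In
  characteristic \<open>2\<close> the algebra is commutative and the ordinary elementary symmetric polynomials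
  already exclude the gap \<open>2\<close>.
\<close>

section \<open>Exponent vectors\<close>

text \<open>The staircase exponents n-1, ..., 1, 0, with all gaps 1, account for n(n-1)/2, and a gap
  2 at position i adds i; a last exponent 1 counts as a gap 2 at position n. Forbidding adjacent
  gaps 2 still allows the positions 2, 4, ..., whose sum is the second summand of the bound. For odd
  n = 2f+1 it also allows 3, 5, ..., n with sum f(f+2) > f(f+1), so a further restriction is needed.
  Once 2, 1, 2 is excluded, gaps 2 are at least three apart unless a gap 0 separates them, and the
  excess over the staircase is at most n(n+3)/6. After rounding this fits for all n >= 2 except n =
  3, where the exponents 3, 2, 1 have degree 6 and the bound is 5. The other exception arises
  because the cofactor b must have positive degree: x^(2,...,2) is e_n with b = 1, and for n >= 2
  its degree 2n exceeds the bound exactly when n is 2 or 3. Explicit relations settle these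
  monomials after division by 2 or 6; in characteristic 3 the condition on |G| gives an invariant
  variable instead.\<close>

definition total_degree :: "nat \<Rightarrow> (nat \<Rightarrow> nat) \<Rightarrow> nat"
  where "total_degree n a = (\<Sum>i\<in>{1..n}. a i)"

definition sq_norm :: "nat \<Rightarrow> (nat \<Rightarrow> nat) \<Rightarrow> nat"
  where "sq_norm n a = (\<Sum>i\<in>{1..n}. (a i)\<^sup>2)"

text \<open>Vacuous for the empty set and for all of {1..n}, so the levels above the largest and
  below the smallest exponent need no separate notion.\<close>

definition gap :: "nat \<Rightarrow> nat \<Rightarrow> nat set \<Rightarrow> (nat \<Rightarrow> nat) \<Rightarrow> bool"
  where "gap n g S a \<longleftrightarrow> (\<forall>s\<in>S. \<forall>t\<in>{1..n} - S. a t + g \<le> a s)"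

lemma gapD: "gap n g S a \<Longrightarrow> s \<in> S \<Longrightarrow> t \<in> {1..n} \<Longrightarrow> t \<notin> S \<Longrightarrow> a t + g \<le> a s"
  by (auto simp: gap_def)

lemma gap_mono: "gap n g S a \<Longrightarrow> g' \<le> g \<Longrightarrow> gap n g' S a"
  unfolding gap_def by (metis add_left_mono le_trans)

abbreviation ind :: "nat set \<Rightarrow> nat \<Rightarrow> nat"
  where "ind S i \<equiv> of_bool (i \<in> S)"

lemma total_degree_add: "total_degree n (\<lambda>i. a i + b i) = total_degree n a + total_degree n b"
  by (simp add: total_degree_def sum.distrib)

lemma sum_ind: "S \<subseteq> {1..n} \<Longrightarrow> (\<Sum>i\<in>{1..n}. f i * ind S i) = sum f S"
  for f :: "nat \<Rightarrow> nat"
  by (simp add: of_bool_def if_distrib[of "\<lambda>x. _ * x"] sum.inter_restrict[symmetric] Int_absorb1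
      cong: if_cong)

lemma sq_norm_add:
  "sq_norm n (\<lambda>i. b i + c i) = sq_norm n b + 2 * (\<Sum>i\<in>{1..n}. b i * c i) + sq_norm n c"
  by (simp add: sq_norm_def power2_eq_square algebra_simps sum.distrib mult_2_right flip: mult_2)

text \<open>\<open>S'\<close> arises from \<open>S\<close> by exchanging equally many elements, and
  each exchange loses at least \<open>g\<close>. The last hypothesis makes the loss available:
  either none is claimed or at least one exchange takes place.\<close>

lemma sum_le_top:
  fixes b :: "nat \<Rightarrow> nat"
  assumes "S \<subseteq> {1..n}" "S' \<subseteq> {1..n}" "card S' = card S" and top: "gap n g S b"
    and pos: "g = 0 \<or> S' \<noteq> S"
  shows "sum b S' + g \<le> sum b S"
proof (cases "S' = S")
  case True
  then show ?thesis using pos by simp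
next
  case False
  have fin: "finite S" "finite S'" using assms(1,2) finite_subset by auto
  have card: "card (S' - S) = card (S - S')"
    using card_Diff_subset_Int[of S' S] card_Diff_subset_Int[of S S'] fin assms(3)
    by (simp add: Int_commute)
  have "S' - S \<noteq> {}"
    using False assms(3) fin by (metis Diff_eq_empty_iff card_subset_eq)
  then have pos: "0 < card (S' - S)" using fin by (simp add: card_gt_0_iff)
  define M where "M = Max (b ` (S' - S))"
  have M: "b t \<le> M" if "t \<in> S' - S" for t
    using that fin by (simp add: M_def)
  have "M \<in> b ` (S' - S)"
    unfolding M_def using fin \<open>S' - S \<noteq> {}\<close> by (intro Max_in) auto
  then obtain t0 where t0: "t0 \<in> S' - S" "M = b t0" by blast
  have M': "M + g \<le> b s" if "s \<in> S - S'" for s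
    using top that t0 assms(2) by (auto simp: gap_def)
  have "sum b (S' - S) + g \<le> card (S' - S) * M + card (S' - S) * g"
    using sum_bounded_above[of "S' - S" b M] M pos by (intro add_mono) auto
  also have "\<dots> = card (S - S') * (M + g)" by (simp add: card algebra_simps)
  also have "\<dots> \<le> sum b (S - S')"
    using sum_bounded_below[of "S - S'" "M + g" b] M' by simp
  finally have "sum b (S' - S) + g \<le> sum b (S - S')" .
  moreover have "sum b S' = sum b (S' - S) + sum b (S \<inter> S')"
    "sum b S = sum b (S - S') + sum b (S \<inter> S')"
    using sum.Int_Diff[of S' b S] sum.Int_Diff[of S b S'] fin by (auto simp: Int_commute)
  ultimately show ?thesis by simp
qed

text \<open>
  Here \<open>w i\<close> stands for the \<open>i\<close>th gap of a sorted exponent vector, lowered by \<open>1\<close> if \<open>i\<close> is not the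
  last index; \<open>w 0 = 1\<close> is a sentinel, the gap above the largest exponent being infinite.
\<close>

lemma weighted_excess_bound:
  fixes w :: "nat \<Rightarrow> int"
  assumes "w 0 = 1" "\<And>i. i \<le> m \<Longrightarrow> w i \<in> {-1, 0, 1}"
    and adj: "\<And>i. Suc i \<le> m \<Longrightarrow> w i = 1 \<Longrightarrow> w (Suc i) \<le> 0"
    and dist2: "\<And>i. Suc (Suc i) \<le> m \<Longrightarrow> w i = 1 \<Longrightarrow> w (Suc i) = 0 \<Longrightarrow> w (Suc (Suc i)) \<le> 0"
  shows "6 * (\<Sum>i\<le>m. int i * w i) \<le> int m * (int m + 3)"
  using assms(2-)
proof (induction m rule: less_induct)
  case (less m)
  have IH: "6 * (\<Sum>i\<le>k. int i * w i) \<le> int k * (int k + 3)" if "k < m" for k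
    using less.prems that by (intro less.IH) auto
  show ?case
  proof (cases m)
    case (Suc m1)
    show ?thesis
    proof (cases "w m = 1")
      case False
      then have "w m \<le> 0" using less.prems(1)[of m] by auto
      then have "int m * w m \<le> 0" by (simp add: mult_nonneg_nonpos)
      then show ?thesis using IH[of m1] Suc by (simp add: algebra_simps)
    next
      case True
      then have "w m1 \<noteq> 1" using less.prems(2)[of m1] Suc by auto
      then have w1: "w m1 = 0 \<or> w m1 = -1" using less.prems(1)[of m1] Suc by auto
      obtain m2 where m2: "m1 = Suc m2" using w1 assms(1) by (cases m1) auto
      \<comment> \<open>If \<open>w m1 = -1\<close>, the last two levels contribute only m - (m-1) =
        1. If \<open>w m1 = 0\<close>, the last three contribute at most m, which is f(m) - f(m-3)
        for f(m) = m(m+3)/6: the block 0, 0, 1 uses up the bound exactly.\<close>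
      show ?thesis
      proof (cases "w m1 = 0")
        case False
        then show ?thesis
          using IH[of m2] True w1 Suc m2 by (simp add: algebra_simps)
      next
        case 0: True
        then have "w m2 \<noteq> 1" using less.prems(3)[of m2] Suc m2 True by auto
        then have w2: "w m2 \<le> 0" using less.prems(1)[of m2] Suc m2 by auto
        obtain m3 where m3: "m2 = Suc m3" using \<open>w m2 \<noteq> 1\<close> assms(1) by (cases m2) auto
        have "int m2 * w m2 \<le> 0" using w2 by (simp add: mult_nonneg_nonpos)
        then show ?thesis
          using IH[of m3] True 0 Suc m2 m3 by (simp add: algebra_simps)
      qed
    qed
  qed simp
qed

text \<open>Abel summation: the drop after index i is shared by the first i+1 terms.\<close>

lemma sum_by_gaps:
  fixes g :: "nat \<Rightarrow> int"
  shows "(\<Sum>i<m. g i) = (\<Sum>i<m. int (Suc i) * (g i - g (Suc i))) + int m * g m"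
  by (induction m) (simp_all add: algebra_simps)

abbreviation degree_bound :: "nat \<Rightarrow> nat"
  where "degree_bound n \<equiv> n * (n - 1) div 2 + (n div 2) * (n div 2 + 1)"

text \<open>The product of floors equals (m^2-1)/4 for odd m and m(m+2)/4 for even m, so these two
  expressions sandwich it.\<close>

lemma degree_bound_asymp:
  "(\<lambda>m::nat. real (m * (m - 1) div 2 + (m div 2) * (m div 2 + 1))) \<sim>[at_top] (\<lambda>m. 3 / 4 * real m ^ 2)"
proof -
  have tri: "real (m * (m - 1) div 2) = real m * (real m - 1) / 2" for m
    by (cases m) (auto simp: real_of_nat_div algebra_simps)
  have bounds: "(real m ^ 2 - 1) / 4 \<le> real ((m div 2) * (m div 2 + 1))"
    "real ((m div 2) * (m div 2 + 1)) \<le> real m * (real m + 2) / 4" for m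
  proof -
    obtain f where "m = 2 * f \<or> m = 2 * f + 1" by (metis oddE evenE)
    then show "(real m ^ 2 - 1) / 4 \<le> real ((m div 2) * (m div 2 + 1))"
      "real ((m div 2) * (m div 2 + 1)) \<le> real m * (real m + 2) / 4"
      by (auto simp: power2_eq_square field_simps)
  qed
  let ?l = "\<lambda>m::nat. real m * (real m - 1) / 2 + (real m ^ 2 - 1) / 4"
  let ?u = "\<lambda>m::nat. real m * (real m - 1) / 2 + real m * (real m + 2) / 4"
  show ?thesis
  proof (rule asymp_equiv_sandwich_real[of ?l _ _ ?u])
    show "?l \<sim>[at_top] (\<lambda>m. 3 / 4 * real m ^ 2)" by real_asymp
    show "?u \<sim>[at_top] (\<lambda>m. 3 / 4 * real m ^ 2)" by real_asymp
    show "\<forall>\<^sub>F m in at_top. real (m * (m - 1) div 2 + m div 2 * (m div 2 + 1)) \<in> {?l m..?u m}"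
      using bounds unfolding of_nat_add tri by (intro always_eventually) simp
  qed
qed

section \<open>Exponent vectors of the terms of E_k\<close>

definition odd_vec :: "nat set \<Rightarrow> nat \<Rightarrow> nat \<Rightarrow> nat"
  where "odd_vec S s i = 2 * ind S i + ind {s} i"

text \<open>Index set of E_k: the pair \<open>(S, s)\<close> stands for the term with the squares
  over \<open>S\<close> and the single odd variable \<open>s\<close>.\<close>

definition flags :: "nat \<Rightarrow> nat \<Rightarrow> (nat set \<times> nat) set"
  where "flags n k = (SIGMA S:{S. S \<subseteq> {1..n} \<and> card S = k}. {1..n} - S)"

lemma finite_subsets_card [simp]: "finite {S. S \<subseteq> {1..n::nat} \<and> card S = k}"
  by (rule finite_subset[of _ "Pow {1..n}"]) auto

lemma finite_flags [simp]: "finite (flags n k)"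
  by (simp add: flags_def)

lemma mem_flags: "(S, s) \<in> flags n k \<longleftrightarrow> S \<subseteq> {1..n} \<and> card S = k \<and> s \<in> {1..n} \<and> s \<notin> S"
  by (auto simp: flags_def)

lemma total_degree_ind: "S \<subseteq> {1..n} \<Longrightarrow> total_degree n (\<lambda>i. r * ind S i) = r * card S"
  by (simp only: total_degree_def sum_ind sum_constant) simp

lemma sq_norm_ind: "S \<subseteq> {1..n} \<Longrightarrow> sq_norm n (\<lambda>i. r * ind S i) = r\<^sup>2 * card S"
proof -
  assume S: "S \<subseteq> {1..n}"
  have "(r * ind S i)\<^sup>2 = r\<^sup>2 * ind S i" for i by simp
  then show ?thesis by (simp only: sq_norm_def sum_ind[OF S] sum_constant) simp
qed

text \<open>Uses that \<open>odd_vec S s\<close> is the sum of the indicators of \<open>S\<close>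
  and of \<open>insert s S\<close>. In this form the inner product can be maximised by applying
  \<open>sum_le_top\<close> to each of the two sums.\<close>

lemma dot_odd_vec:
  assumes "(S, s) \<in> flags n k"
  shows "(\<Sum>i\<in>{1..n}. b i * odd_vec S s i) = sum b S + sum b (insert s S)"
proof -
  have s: "S \<subseteq> {1..n}" "s \<in> {1..n}" "s \<notin> S" using assms by (auto simp: mem_flags)
  have "b i * odd_vec S s i = (2 * b i) * ind S i + b i * ind {s} i" for i
    by (simp add: odd_vec_def)
  then have "(\<Sum>i\<in>{1..n}. b i * odd_vec S s i) = (\<Sum>i\<in>S. 2 * b i) + sum b {s}"
    using s sum_ind[of "{s}" n b] by (simp only: sum.distrib sum_ind) simp
  also have "\<dots> = 2 * sum b S + b s"
    by (simp add: sum_distrib_left)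
  finally show ?thesis using s finite_subset[OF s(1)] by simp
qed

lemma total_degree_odd_vec: "(S, s) \<in> flags n k \<Longrightarrow> total_degree n (odd_vec S s) = 2 * k + 1"
  using dot_odd_vec[of S s n k "\<lambda>_. 1"] finite_subset[of S "{1..n}"]
  by (simp add: total_degree_def mem_flags)

lemma sq_norm_odd_vec: "(S, s) \<in> flags n k \<Longrightarrow> sq_norm n (odd_vec S s) = 4 * k + 1"
proof -
  assume S: "(S, s) \<in> flags n k"
  have "sq_norm n (odd_vec S s) = (\<Sum>i\<in>{1..n}. odd_vec S s i * odd_vec S s i)"
    by (simp add: sq_norm_def power2_eq_square)
  also have "\<dots> = sum (odd_vec S s) S + sum (odd_vec S s) (insert s S)"
    by (rule dot_odd_vec[OF S])
  also have "sum (odd_vec S s) S = (\<Sum>i\<in>S. 2)"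
    using S by (intro sum.cong) (auto simp: odd_vec_def mem_flags)
  finally show ?thesis
    using S finite_subset[of S "{1..n}"] \<open>sum (odd_vec S s) S = (\<Sum>i\<in>S. 2)\<close>
    by (auto simp: mem_flags) (simp add: odd_vec_def)
qed

section \<open>Reduction by leading monomials\<close>

lemma sign_cancel: "(-1) ^ k * ((-1) ^ k * x) = (x :: 'a :: ring_1)"
  by (cases "even k") auto

text \<open>Separates the combinatorics of exponents from the skew algebra: \<open>X a\<close> will
  be the sorted monomial and \<open>D\<close> the decomposable elements, an additive group.
  Multiplication in the ring serves to write signs. Exponent vectors are total functions, hence
  \<open>X_cong\<close>.\<close>

locale monomial_span =
  fixes n :: nat and X :: "(nat \<Rightarrow> nat) \<Rightarrow> 'v::ring_1" and D :: "'v set"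
  assumes X_cong: "(\<And>i. i \<in> {1..n} \<Longrightarrow> a i = a' i) \<Longrightarrow> X a = X a'"
    and zero_mem: "0 \<in> D"
    and add_mem: "x \<in> D \<Longrightarrow> y \<in> D \<Longrightarrow> x + y \<in> D"
    and uminus_mem: "x \<in> D \<Longrightarrow> - x \<in> D"
begin

text \<open>The induction hypothesis of the reduction, stated for a fixed total degree.\<close>

definition lower_mem :: "(nat \<Rightarrow> nat) \<Rightarrow> bool"
  where "lower_mem a \<longleftrightarrow> (\<forall>a'. total_degree n a' = total_degree n a \<longrightarrow> sq_norm n a' < sq_norm n a \<longrightarrow> X a' \<in> D)"

lemma diff_mem: "x \<in> D \<Longrightarrow> y \<in> D \<Longrightarrow> x - y \<in> D"
  using add_mem[OF _ uminus_mem] by fastforce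

lemma sum_mem: "(\<And>j. j \<in> J \<Longrightarrow> f j \<in> D) \<Longrightarrow> sum f J \<in> D"
  by (induction J rule: infinite_finite_induct) (auto intro: zero_mem add_mem)

lemma sign_mem: "x \<in> D \<Longrightarrow> (-1) ^ k * x \<in> D"
  by (cases "even k") (auto intro: uminus_mem)

lemma sign_mem_iff: "(-1) ^ k * x \<in> D \<longleftrightarrow> x \<in> D"
  by (cases "even k") (auto intro: uminus_mem dest: uminus_mem)

lemma subset_sum_mem:
  assumes "sum f J \<in> D" "finite J" "K \<subseteq> J" "\<And>j. j \<in> J - K \<Longrightarrow> f j \<in> D"
  shows "sum f K \<in> D"
proof -
  have "sum f K = sum f J - sum f (J - K)"
    using sum.subset_diff[OF assms(3,2), of f] by simp
  then show ?thesis using assms by (auto intro!: diff_mem sum_mem)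
qed

text \<open>Splitting off \<open>r\<close> times the indicator of \<open>S\<close> leaves a cofactor
  \<open>b\<close> whose gap at \<open>S\<close> is still at least 1. So \<open>S\<close> alone
  maximises the sum of \<open>b\<close> over sets of its size, and all other terms have smaller
  square norm. The strict degree hypothesis makes \<open>b\<close> nonconstant.\<close>

lemma reduce_top_set:
  assumes rel: "\<And>k b. 1 \<le> k \<Longrightarrow> 1 \<le> total_degree n b \<Longrightarrow>
      (\<Sum>S | S \<subseteq> {1..n} \<and> card S = k. X (\<lambda>i. b i + r * ind S i)) \<in> D"
    and S: "S \<subseteq> {1..n}" "S \<noteq> {}" "gap n (r + 1) S a" "\<And>s. s \<in> S \<Longrightarrow> r \<le> a s"
    and total_degree: "r * card S < total_degree n a" and low: "lower_mem a" and r: "1 \<le> r"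
  shows "X a \<in> D"
proof -
  define b where "b = (\<lambda>i. a i - r * ind S i)"
  let ?J = "{S'. S' \<subseteq> {1..n} \<and> card S' = card S}"
  have a: "a = (\<lambda>i. b i + r * ind S i)"
    using S(4) by (auto simp: b_def)
  have deg_a: "total_degree n a = total_degree n b + r * card S"
    by (subst a) (simp add: total_degree_add total_degree_ind[OF S(1)])
  have "gap n 1 S b"
    unfolding gap_def
  proof (intro ballI)
    fix i t assume "i \<in> S" "t \<in> {1..n} - S"
    then show "b t + 1 \<le> b i" using gapD[OF S(3), of i t] by (simp add: b_def)
  qed
  have "1 \<le> card S"
    using S(1,2) finite_subset[OF S(1)] by (simp add: Suc_le_eq card_gt_0_iff)
  have others: "X (\<lambda>i. b i + r * ind S' i) \<in> D" if "S' \<in> ?J - {S}" for S'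
  proof -
    have S': "S' \<subseteq> {1..n}" "card S' = card S" "S' \<noteq> S" using that by auto
    have dot: "(\<Sum>i\<in>{1..n}. b i * (r * ind T i)) = r * sum b T" if "T \<subseteq> {1..n}" for T
      using sum_ind[OF that, of "\<lambda>i. r * b i"] by (simp add: sum_distrib_left mult_ac)
    have "sum b S' < sum b S"
      using sum_le_top[OF S(1) S'(1,2) \<open>gap n 1 S b\<close>] S'(3) by simp
    then have "sq_norm n (\<lambda>i. b i + r * ind S' i) < sq_norm n (\<lambda>i. b i + r * ind S i)"
      using r S'(2) by (simp only: sq_norm_add dot S(1) S'(1) sq_norm_ind) simp
    then show ?thesis
      using low deg_a S' unfolding lower_mem_def a[symmetric]
      by (simp add: total_degree_add total_degree_ind)
  qed
  have "1 \<le> total_degree n b" using total_degree deg_a by simp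
  have "(\<Sum>S'\<in>{S}. X (\<lambda>i. b i + r * ind S' i)) \<in> D"
    by (rule subset_sum_mem[OF rel[OF \<open>1 \<le> card S\<close> \<open>1 \<le> total_degree n b\<close>] _ _ others])
      (use S(1) in auto)
  then show ?thesis by (subst a) simp
qed

end

text \<open>The relations express that e_k x^b and E_k x^b are decomposable. Squares are central, so
  only the odd variable x_s produces a sign, when it passes the letters of x^b below s.\<close>

locale skew_monomial_span = monomial_span n X D for n X D +
  assumes even_rel: "1 \<le> k \<Longrightarrow> 1 \<le> total_degree n b \<Longrightarrow>
      (\<Sum>S | S \<subseteq> {1..n} \<and> card S = k. X (\<lambda>i. b i + 2 * ind S i)) \<in> D"
    and odd_rel: "1 \<le> total_degree n b \<Longrightarrow>
      (\<Sum>(S, s)\<in>flags n k. (-1) ^ (\<Sum>j\<in>{1..<s}. b j) * X (\<lambda>i. b i + odd_vec S s i)) \<in> D"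
begin

text \<open>\<open>K\<close> collects the terms that may be leading. It has one element when the
  maximum is unique and two when the cofactor has a tie.\<close>

lemma odd_rel_lead:
  assumes S: "(S, s) \<in> flags n k" and total_degree: "2 * k + 1 < total_degree n a" and low: "lower_mem a"
    and a: "a = (\<lambda>i. b i + odd_vec S s i)"
    and K: "(S, s) \<in> K" "K \<subseteq> flags n k"
    and less: "\<And>S' s'. (S', s') \<in> flags n k - K \<Longrightarrow>
      sum b S' + sum b (insert s' S') < sum b S + sum b (insert s S)"
  shows "(\<Sum>(S, s)\<in>K. (-1) ^ (\<Sum>j\<in>{1..<s}. b j) * X (\<lambda>i. b i + odd_vec S s i)) \<in> D"
proof -
  have deg_a: "total_degree n a = total_degree n b + 2 * k + 1"
    by (subst a) (simp add: total_degree_add total_degree_odd_vec[OF S])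
  have "X (\<lambda>i. b i + odd_vec S' s' i) \<in> D" if S': "(S', s') \<in> flags n k - K" for S' s'
  proof -
    have "sq_norm n (\<lambda>i. b i + odd_vec S' s' i) < sq_norm n a"
      unfolding a sq_norm_add dot_odd_vec[OF S] sq_norm_odd_vec[OF S]
      using less[OF S'] dot_odd_vec[of S' s' n k b] sq_norm_odd_vec[of S' s' n k] S' by auto
    then show ?thesis
      using low deg_a S' unfolding lower_mem_def by (simp add: total_degree_add total_degree_odd_vec[of S' s' n k])
  qed
  then show ?thesis
    using odd_rel[of b k] total_degree deg_a K(2)
    by (intro subset_sum_mem[of _ "flags n k" K]) (auto intro: sign_mem)
qed

text \<open>Subtracting 2 on \<open>S\<close> and 1 at \<open>s\<close> lowers both gaps by 1, so
  each keeps at least 1. A different flag changes \<open>S\<close>, or keeps \<open>S\<close> and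
  changes \<open>insert s S\<close>; either way one of the two sums drops strictly while the other
  does not grow.\<close>

lemma reduce_adjacent:
  assumes S: "S \<subseteq> {1..n}" "s \<in> {1..n}" "s \<notin> S"
    and gap: "gap n 2 S a" "gap n 2 (insert s S) a" and "1 \<le> a s"
    and total_degree: "2 * card S + 1 < total_degree n a" and low: "lower_mem a"
  shows "X a \<in> D"
proof -
  define b where "b = (\<lambda>i. a i - odd_vec S s i)"
  have "a i \<ge> 3" if "i \<in> S" for i
    using gapD[OF gap(1) that S(2,3)] \<open>1 \<le> a s\<close> by simp
  then have a: "a = (\<lambda>i. b i + odd_vec S s i)"
    using \<open>1 \<le> a s\<close> by (force simp: b_def odd_vec_def)
  have fl: "(S, s) \<in> flags n (card S)" using S by (simp add: mem_flags)
  have bS: "b i = a i - 2" if "i \<in> S" for i using that S(3) by (auto simp: b_def odd_vec_def)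
  have bs: "b s = a s - 1" using S(3) by (simp add: b_def odd_vec_def)
  have bt: "b t = a t" if "t \<notin> S" "t \<noteq> s" for t using that by (simp add: b_def odd_vec_def)
  have "gap n 1 S b"
    unfolding gap_def
  proof (intro ballI)
    fix i t assume i: "i \<in> S" and t: "t \<in> {1..n} - S"
    have "a t + 2 \<le> a i" using gap(1) i t by (auto simp: gap_def)
    moreover have "a s + 2 \<le> a i" using gap(1) i S by (auto simp: gap_def)
    moreover have "t = s \<or> a t + 2 \<le> a s" using gap(2) t by (auto simp: gap_def)
    ultimately show "b t + 1 \<le> b i"
      using \<open>1 \<le> a s\<close> bS[OF i] bs bt[of t] t by (cases "t = s") auto
  qed
  have "gap n 1 (insert s S) b"
    unfolding gap_def
  proof (intro ballI)
    fix i t assume i: "i \<in> insert s S" and t: "t \<in> {1..n} - insert s S"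
    have "a t + 2 \<le> a s" using gap(2) t by (auto simp: gap_def)
    moreover have "i = s \<or> a s + 2 \<le> a i" using gap(1) i S by (auto simp: gap_def)
    ultimately show "b t + 1 \<le> b i"
      using bS[of i] bs bt[of t] t i by (cases "i = s") auto
  qed
  have "sum b S' + sum b (insert s' S') < sum b S + sum b (insert s S)"
    if "(S', s') \<in> flags n (card S) - {(S, s)}" for S' s'
  proof -
    have S': "S' \<subseteq> {1..n}" "card S' = card S" "s' \<in> {1..n}" "s' \<notin> S'" "S' \<noteq> S \<or> s' \<noteq> s"
      using that by (auto simp: mem_flags)
    have c: "insert s' S' \<subseteq> {1..n}" "card (insert s' S') = card (insert s S)" "insert s S \<subseteq> {1..n}"
      using S S' finite_subset[OF S(1)] finite_subset[OF S'(1)] by auto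
    have "gap n 0 S b" "gap n 0 (insert s S) b"
      using \<open>gap n 1 S b\<close> \<open>gap n 1 (insert s S) b\<close> by (auto elim: gap_mono)
    then have le: "sum b S' \<le> sum b S" "sum b (insert s' S') \<le> sum b (insert s S)"
      using sum_le_top[OF S(1) S'(1,2), of 0 b] sum_le_top[OF c(3,1,2), of 0 b] by auto
    show ?thesis
    proof (cases "S' = S")
      case False
      then show ?thesis
        using sum_le_top[OF S(1) S'(1,2) \<open>gap n 1 S b\<close>] le(2) by simp
    next
      case True
      then have "insert s' S' \<noteq> insert s S" using S'(4,5) by auto
      then show ?thesis
        using sum_le_top[OF c(3,1,2) \<open>gap n 1 (insert s S) b\<close>] le(1) by simp
    qed
  qed
  then have "(\<Sum>(S, s)\<in>{(S, s)}. (-1) ^ (\<Sum>j\<in>{1..<s}. b j) * X (\<lambda>i. b i + odd_vec S s i)) \<in> D"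
    using fl total_degree low a by (intro odd_rel_lead[of S s "card S" a b]) auto
  then show ?thesis using a by (simp add: sign_mem_iff)
qed

text \<open>
  Let \<open>a'\<close> arise from \<open>a\<close> by exchanging the values at \<open>u\<close> and \<open>v\<close>. Removing either
  \<open>2 \<cdot> S + u\<close> or \<open>2 \<cdot> (S + u) + v\<close> from \<open>a\<close> gives a relation between \<open>X a\<close> and \<open>X a'\<close> alone. The two
  cofactors differ by \<open>1\<close> at \<open>u\<close> and at \<open>v\<close>, which makes the relative signs opposite.
\<close>

lemma double_mem_of_close_gaps:
  assumes S: "S \<subseteq> {1..n}" "u \<in> {1..n}" "v \<in> {1..n}" "u \<notin> S" "v \<notin> S" "u \<noteq> v"
    and gap: "gap n 2 S a" "gap n 2 (insert u (insert v S)) a" and uv: "a u = a v + 1" "1 \<le> a v"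
    and total_degree: "2 * card S + 3 < total_degree n a" and low: "lower_mem a"
  shows "X a + X a \<in> D"
proof -
  let ?T = "insert u (insert v S)"
  define b where "b = (\<lambda>i. a i - odd_vec S u i)"
  define b' where "b' = (\<lambda>i. a i - odd_vec (insert u S) v i)"
  note fin = finite_subset[OF S(1)]
  have aS: "a i \<ge> a u + 2" if "i \<in> S" for i
    using gap(1) that S by (fastforce simp: gap_def)
  have at: "a t + 2 \<le> a v" if "t \<in> {1..n} - ?T" for t
    using gap(2) that by (auto simp: gap_def)
  have a: "a = (\<lambda>i. b i + odd_vec S u i)" and a': "a = (\<lambda>i. b' i + odd_vec (insert u S) v i)"
    using aS uv S(4-6) by (force simp: b_def b'_def odd_vec_def)+
  have fl: "(S, u) \<in> flags n (card S)" "(S, v) \<in> flags n (card S)"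
    "(insert u S, v) \<in> flags n (card S + 1)" "(insert v S, u) \<in> flags n (card S + 1)"
    using S fin by (auto simp: mem_flags)
  have bS: "b i = a i - 2" "b' i = a i - 2" if "i \<in> S" for i
    using that S by (auto simp: b_def b'_def odd_vec_def)
  have buv: "b u = a v" "b v = a v" "b' u = a v - 1" "b' v = a v - 1"
    using S uv by (auto simp: b_def b'_def odd_vec_def)
  have bt: "b t = a t" "b' t = a t" if "t \<notin> ?T" for t
    using that by (auto simp: b_def b'_def odd_vec_def)
  have lt: "b t < a v" "b' t < a v - 1" if "t \<in> {1..n} - ?T" for t
    using at[OF that] bt[of t] that by auto
  have gt: "a v < b i" "a v - 1 < b' i" if "i \<in> S" for i
    using aS[OF that] bS[OF that] uv by auto
  \<comment> \<open>Applied to \<open>b\<close> with m = a v and to \<open>b'\<close> with m = a v -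
    1: in both cofactors \<open>u\<close> and \<open>v\<close> share the value m, strictly between
    the values on \<open>S\<close> and those outside \<open>?T\<close>.\<close>
  have gaps: "gap n 1 S c" "gap n 1 ?T c" "gap n 0 (insert u S) c"
    if "\<And>i. i \<in> S \<Longrightarrow> m < c i" "c u = m" "c v = m" "\<And>t. t \<in> {1..n} - ?T \<Longrightarrow> c t < m" for c m
  proof -
    have out: "c t \<le> m" if "t \<in> {1..n} - S" for t
      using \<open>\<And>t. t \<in> {1..n} - ?T \<Longrightarrow> c t < m\<close>[of t] \<open>c u = m\<close> \<open>c v = m\<close> that
      by (cases "t = u \<or> t = v") auto
    have S_t: "c t + 1 \<le> c i" if "i \<in> S" "t \<in> {1..n} - S" for i t
      using \<open>\<And>i. i \<in> S \<Longrightarrow> m < c i\<close>[OF that(1)] out[OF that(2)] by simp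
    have T_i: "m \<le> c i" if "i \<in> ?T" for i
      using \<open>\<And>i. i \<in> S \<Longrightarrow> m < c i\<close>[of i] \<open>c u = m\<close> \<open>c v = m\<close> that by auto
    show "gap n 1 S c"
      using S_t unfolding gap_def by blast
    show "gap n 1 ?T c"
      unfolding gap_def
    proof (intro ballI)
      fix i t assume "i \<in> ?T" "t \<in> {1..n} - ?T"
      then show "c t + 1 \<le> c i"
        using T_i[of i] \<open>\<And>t. t \<in> {1..n} - ?T \<Longrightarrow> c t < m\<close>[of t] by simp
    qed
    show "gap n 0 (insert u S) c"
      unfolding gap_def
    proof (intro ballI)
      fix i t assume i: "i \<in> insert u S" and t: "t \<in> {1..n} - insert u S"
      then have "c t \<le> m" using out[of t] by blast
      then show "c t + 0 \<le> c i" using T_i[of i] i by auto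
    qed
  qed
  note gb = gaps[of "a v" b, OF gt(1) buv(1,2) lt(1)]
    and gb' = gaps[of "a v - 1" b', OF gt(2) buv(3,4) lt(2)]
  have uS: "insert u S \<subseteq> {1..n}" "?T \<subseteq> {1..n}" using S by auto
  \<comment> \<open>Because of the tie at \<open>u\<close> and \<open>v\<close>, either of them can
    carry the odd exponent.\<close>
  have rel: "(\<Sum>(S, s)\<in>{(S, u), (S, v)}. (-1) ^ (\<Sum>j\<in>{1..<s}. b j) * X (\<lambda>i. b i + odd_vec S s i)) \<in> D"
  proof (rule odd_rel_lead[OF fl(1) _ low a])
    fix S' s' assume *: "(S', s') \<in> flags n (card S) - {(S, u), (S, v)}"
    then have S': "S' \<subseteq> {1..n}" "card S' = card S" "s' \<in> {1..n}" "s' \<notin> S'"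
      by (auto simp: mem_flags)
    note fin' = finite_subset[OF S'(1)]
    show "sum b S' + sum b (insert s' S') < sum b S + sum b (insert u S)"
    proof (cases "S' = S")
      case True
      then have "b s' < b u" using * lt(1)[of s'] S' buv by auto
      then show ?thesis using True S S' fin by simp
    next
      case False
      have "sum b (insert s' S') \<le> sum b (insert u S)"
        using sum_le_top[OF uS(1) _ _ gb(3), of "insert s' S'"] S S' fin fin' by simp
      then show ?thesis
        using sum_le_top[OF S(1) S'(1,2) gb(1)] False by simp
    qed
  qed (use fl total_degree in auto)
  \<comment> \<open>The tie now concerns which of \<open>u\<close> and \<open>v\<close> joins the
    squares and which carries the odd exponent, so the roles in the two terms are reversed.\<close>
  have rel': "(\<Sum>(S, s)\<in>{(insert u S, v), (insert v S, u)}.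
      (-1) ^ (\<Sum>j\<in>{1..<s}. b' j) * X (\<lambda>i. b' i + odd_vec S s i)) \<in> D"
  proof (rule odd_rel_lead[OF fl(3) _ low a'])
    fix S' s' assume *: "(S', s') \<in> flags n (card S + 1) - {(insert u S, v), (insert v S, u)}"
    then have S': "S' \<subseteq> {1..n}" "card S' = card (insert u S)" "s' \<in> {1..n}" "s' \<notin> S'"
      using S fin by (auto simp: mem_flags)
    note fin' = finite_subset[OF S'(1)]
    have T: "insert v (insert u S) = ?T" by blast
    have le: "sum b' S' \<le> sum b' (insert u S)"
      using sum_le_top[OF uS(1) S'(1,2) gb'(3)] by simp
    have cT: "card (insert s' S') = card ?T" using S S' fin fin' by simp
    show "sum b' S' + sum b' (insert s' S') < sum b' (insert u S) + sum b' (insert v (insert u S))"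
    proof (cases "insert s' S' = ?T")
      case True
      then have S'_eq: "S' = ?T - {s'}" using S'(4) by blast
      then have "s' \<noteq> u \<and> s' \<noteq> v" using * S(4-6) by (auto simp: insert_Diff_if)
      then have "b' s' > b' v" using True gt(2)[of s'] buv by auto
      moreover have "sum b' (insert s' S') = b' s' + sum b' S'" using S'(4) fin' by simp
      moreover have "sum b' ?T = b' v + sum b' (insert u S)"
        using S fin by (subst T[symmetric]) simp
      ultimately show ?thesis using True unfolding T by simp
    next
      case False
      then show ?thesis
        using sum_le_top[OF uS(2) _ cT gb'(2)] S'(1,3) le unfolding T by simp
    qed
  qed (use fl total_degree S fin in auto)
  define a\<tau> where "a\<tau> = (\<lambda>i. b i + odd_vec S v i)"
  have a\<tau>': "a\<tau> = (\<lambda>i. b' i + odd_vec (insert v S) u i)"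
    using aS uv S(4-6) by (force simp: a\<tau>_def b_def b'_def odd_vec_def)
  define p where "p = (\<lambda>s. \<Sum>j\<in>{1..<s}. b j)"
  define p' where "p' = (\<lambda>s. \<Sum>j\<in>{1..<s}. b' j)"
  have bb: "b j = b' j + (ind {u} j + ind {v} j)" for j
  proof -
    consider "j \<in> S" | "j = u" | "j = v" | "j \<notin> ?T" by blast
    then show ?thesis
    proof cases
      case 1
      then show ?thesis using bS[of j] S(4,5) by auto
    next
      case 4
      then show ?thesis using bt[of j] by auto
    qed (use buv uv S(6) in auto)
  qed
  have pp: "p s = p' s + (of_bool (u < s) + of_bool (v < s))" for s
  proof -
    have "(\<Sum>j\<in>{1..<s}. ind {w} j) = of_bool (w < s)" if "w \<in> {1..n}" for w
      using that by (simp add: of_bool_def)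
    then show ?thesis using S(2,3) unfolding p_def p'_def bb sum.distrib by simp
  qed
  have r: "(-1) ^ p u * X a + (-1) ^ p v * X a\<tau> \<in> D"
    using rel S(6) unfolding p_def a\<tau>_def a[symmetric] by (auto simp: a[symmetric])
  have r': "(-1) ^ p' v * X a + (-1) ^ p' u * X a\<tau> \<in> D"
    using rel' S(4-6) unfolding p'_def a\<tau>' by (auto simp: a'[symmetric])
  have 1: "X a + (-1) ^ (p u + p v) * X a\<tau> \<in> D"
    using sign_mem[OF r, of "p u"] by (simp add: distrib_left power_add mult.assoc sign_cancel)
  have 2: "X a + (-1) ^ (p' u + p' v) * X a\<tau> \<in> D"
    using sign_mem[OF r', of "p' v"]
    by (simp add: distrib_left power_add mult.assoc sign_cancel power_commutes
        add.commute[of "p' u"])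
  \<comment> \<open>Exactly one of u < v and v < u holds, so the two exponents differ by 1 in
    parity; adding the relations then cancels the exchanged monomial.\<close>
  have "even (p u + p v) \<longleftrightarrow> odd (p' u + p' v)"
    using S(6) by (auto simp: pp)
  then show ?thesis
    using add_mem[OF 1 2] by (cases "even (p u + p v)") auto
qed

end

section \<open>Sorted exponents and their gaps\<close>

lemma sorted_enumeration:
  fixes a :: "nat \<Rightarrow> nat"
  obtains p where "bij_betw p {..<n} {1..n}" "\<And>i j. i \<le> j \<Longrightarrow> j < n \<Longrightarrow> a (p j) \<le> a (p i)"
proof -
  define xs where "xs = rev (sort_key a [1..<Suc n])"
  have xs: "length xs = n" "set xs = {1..n}" "distinct xs"
    by (auto simp: xs_def)
  have "sorted (map a (sort_key a [1..<Suc n]))" by simp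
  then have srt: "sorted_wrt (\<lambda>x y. a y \<le> a x) xs"
    unfolding xs_def sorted_wrt_rev by (simp add: sorted_map)
  show thesis
  proof
    show "bij_betw ((!) xs) {..<n} {1..n}"
      using xs by (intro bij_betw_nth) auto
    show "a (xs ! j) \<le> a (xs ! i)" if "i \<le> j" "j < n" for i j
      using srt that xs(1) by (cases "i = j") (auto simp: sorted_wrt_iff_nth_less)
  qed
qed

text \<open>Above the bound every cofactor used below has positive degree, except when all of
  x^(2,...,2) would be split off; that can happen only for n = 2 and n = 3.\<close>

lemma two_mult_le_degree_bound:
  assumes "2 \<le> n"
  shows "2 * n - 1 \<le> degree_bound n" "n = 2 \<or> n = 3 \<or> 2 * n \<le> degree_bound n"
proof -
  have "2 * n \<le> degree_bound n" if "5 < n"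
  proof -
    have "(2 * n) * 2 \<le> n * (n - 1)" using that mult_le_mono[of n n 4 "n - 1"] by simp
    then have "2 * n \<le> n * (n - 1) div 2" by (simp only: less_eq_div_iff_mult_less_eq)
    then show ?thesis by linarith
  qed
  moreover have "n = 2 \<or> n = 3 \<or> n = 4 \<or> n = 5 \<or> 5 < n" using assms by linarith
  ultimately have "n = 2 \<or> n = 3 \<or> 2 * n \<le> degree_bound n" by fastforce
  then show "2 * n - 1 \<le> degree_bound n" "n = 2 \<or> n = 3 \<or> 2 * n \<le> degree_bound n"
    using diff_le_self[of "2 * n" 1] by (auto dest: le_trans simp del: diff_le_self)
qed

text \<open>Both sides are multiplied by 6 to avoid fractions, and integrality absorbs a remainder
  up to 5. For n = 3 the comparison is 18 against 17 and fails.\<close>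

lemma excess_le_degree_bound:
  assumes "2 \<le> n" "n \<noteq> 3" and m: "6 * m \<le> int n * (int n + 3) + 3 * int n * (int n - 1)"
  shows "m \<le> int (degree_bound n)"
proof -
  have tri: "2 * int (n * (n - 1) div 2) = int n * (int n - 1)"
  proof -
    have "even (n * (n - 1))" using assms(1) by auto
    then have "2 * (n * (n - 1) div 2) = n * (n - 1)" by simp
    then show ?thesis using assms(1) by (metis of_nat_mult of_nat_numeral of_nat_diff
      One_nat_def Suc_1 Suc_leD of_nat_1)
  qed
  obtain f where f: "n = 2 * f \<or> n = 2 * f + 1" by (metis oddE evenE)
  have "int n * (int n + 3) \<le> 6 * (int (n div 2) * (int (n div 2) + 1)) + 5"
    using f
  proof
    assume n: "n = 2 * f"
    then show ?thesis by (simp add: algebra_simps)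
  next
    assume n: "n = 2 * f + 1"
    then have "f \<ge> 2" using assms by (cases "f = 0 \<or> f = 1") auto
    then have "2 * int f \<le> int f * int f" by simp
    then show ?thesis using n by (simp add: algebra_simps)
  qed
  then have "6 * m \<le> 6 * int (degree_bound n) + 5"
    using m tri by (simp add: algebra_simps)
  moreover have "6 * m \<le> 6 * b + 5 \<Longrightarrow> m \<le> b" for b :: int by linarith
  ultimately show ?thesis by blast
qed

text \<open>The enumeration starts at 0, so the k-th drop lies between \<open>p (k - 1)\<close> and
  \<open>p k\<close>; the n-th one goes down to 0.\<close>

lemma total_degree_by_levels:
  assumes "bij_betw p {..<n} {1..n}"
  shows "int (total_degree n a) = (\<Sum>k\<in>{1..n}. int k *
    (int (a (p (k - 1))) - (if k < n then int (a (p k)) else 0)))"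
proof -
  let ?g = "\<lambda>k. if k < n then int (a (p k)) else 0"
  have "int (total_degree n a) = (\<Sum>k<n. int (a (p k)))"
    using sum.reindex_bij_betw[OF assms, of "\<lambda>i. int (a i)"] by (simp add: total_degree_def)
  also have "\<dots> = (\<Sum>k<n. ?g k)" by simp
  also have "\<dots> = (\<Sum>k<n. int (Suc k) * (?g k - ?g (Suc k)))"
    by (subst sum_by_gaps) simp
  also have "\<dots> = (\<Sum>k\<in>{1..n}. int k * (int (a (p (k - 1))) - ?g k))"
    by (rule sum.reindex_bij_witness[of _ "\<lambda>k. k - 1" Suc]) auto
  finally show ?thesis .
qed

text \<open>For sorted values the gap of an initial segment is the single drop at its end. For k = 0
  and k = n nothing is to be checked.\<close>

lemma gap_prefix:
  fixes p a :: "nat \<Rightarrow> nat"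
  assumes p: "bij_betw p {..<n} {1..n}" "\<And>i j. i \<le> j \<Longrightarrow> j < n \<Longrightarrow> a (p j) \<le> a (p i)"
    and "k \<le> n" and d: "1 \<le> k \<Longrightarrow> k < n \<Longrightarrow> a (p k) + d \<le> a (p (k - 1))"
  shows "gap n d (p ` {..<k}) a"
  unfolding gap_def
proof (intro ballI)
  fix s t assume s: "s \<in> p ` {..<k}" and t: "t \<in> {1..n} - p ` {..<k}"
  have "{1..n} = p ` {..<n}" using p(1) by (simp add: bij_betw_def)
  then obtain j where j: "j < n" "\<not> j < k" "t = p j" using t by blast
  obtain i where i: "i < k" "s = p i" using s by blast
  have le: "a t \<le> a (p k)" "a (p (k - 1)) \<le> a s" and k: "1 \<le> k" "k < n"
    using p(2)[of k j] p(2)[of i "k - 1"] \<open>k \<le> n\<close> i j by auto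
  show "a t + d \<le> a s" using d[OF k] le by linarith
qed

context skew_monomial_span
begin

text \<open>Collects what the reductions say about a monomial that is not in \<open>D\<close>
  although all smaller ones of its degree are. The bound 2n - 1 is the largest degree split off by
  an odd relation.\<close>

lemma minimal_levels:
  assumes half: "\<And>x. x + x \<in> D \<Longrightarrow> x \<in> D" and "2 \<le> n"
    and a: "X a \<notin> D" "lower_mem a" "2 * n - 1 < total_degree n a"
    and two: "X (\<lambda>_. 2) \<in> D \<or> 2 * n < total_degree n a"
    and p: "bij_betw p {..<n} {1..n}" "\<And>i j. i \<le> j \<Longrightarrow> j < n \<Longrightarrow> a (p j) \<le> a (p i)"
  obtains w :: "nat \<Rightarrow> int" where "w 0 = 1" "\<And>i. i \<le> n \<Longrightarrow> w i \<in> {-1, 0, 1}"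
    "\<And>i. Suc i \<le> n \<Longrightarrow> w i = 1 \<Longrightarrow> w (Suc i) \<le> 0"
    "\<And>i. Suc (Suc i) \<le> n \<Longrightarrow> w i = 1 \<Longrightarrow> w (Suc i) = 0 \<Longrightarrow> w (Suc (Suc i)) \<le> 0"
    "\<And>i. 1 \<le> i \<Longrightarrow> i < n \<Longrightarrow> int (a (p (i - 1))) = int (a (p i)) + w i + 1"
    "int (a (p (n - 1))) = w n"
proof -
  define w where "w = (\<lambda>k. if k = 0 then 1 else if k < n then int (a (p (k - 1))) - int (a (p k)) - 1
    else int (a (p (n - 1))))"
  let ?S = "\<lambda>k. p ` {..<k}"
  have inj: "p i = p j \<longleftrightarrow> i = j" if "i < n" "j < n" for i j
    using p(1) that by (auto simp: bij_betw_def inj_on_def)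
  have img: "p ` {..<n} = {1..n}" using p(1) by (simp add: bij_betw_def)
  have S: "?S k \<subseteq> {1..n}" "card (?S k) = k" if "k \<le> n" for k
    using that img card_image[of p "{..<k}"] inj by (auto simp: inj_on_def)
  have nS: "p i \<in> {1..n}" "p i \<in> ?S k \<longleftrightarrow> i < k" if "i < n" "k \<le> n" for i k
    using that img inj by auto
  have S_Suc: "?S (Suc k) = insert (p k) (?S k)" for k
    by (simp add: lessThan_Suc)
  have gap: "gap n d (?S k) a"
    if "k \<le> n" "1 \<le> k \<Longrightarrow> k < n \<Longrightarrow> int d \<le> w k + 1" for k d
    using that by (intro gap_prefix p) (auto simp: w_def split: if_splits)
  have ge1: "1 \<le> a (p i)" if "Suc i \<le> n" "w (Suc i) = 1" for i
    using that by (cases "Suc i = n") (auto simp: w_def split: if_splits)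
  have top: "w k \<le> 1" if "k \<le> n" for k
  proof (rule ccontr)
    assume k: "\<not> w k \<le> 1"
    then have "1 \<le> k" by (cases k) (auto simp: w_def)
    have "2 \<le> a (p (k - 1))"
      using k \<open>1 \<le> k\<close> that by (auto simp: w_def split: if_splits)
    have ge2: "2 \<le> a i" if i: "i \<in> ?S k" for i
    proof -
      obtain j where "i = p j" "j < k" using i by blast
      then have "a (p (k - 1)) \<le> a i" using p(2)[of j "k - 1"] \<open>k \<le> n\<close> by simp
      then show ?thesis using \<open>2 \<le> a (p (k - 1))\<close> by simp
    qed
    have "gap n (2 + 1) (?S k) a" using k by (intro gap that) auto
    have "X a \<in> D"
    proof (cases "2 * k < total_degree n a")
      case True
      then show ?thesis
        using even_rel S[OF that] \<open>gap n (2 + 1) (?S k) a\<close> ge2 \<open>1 \<le> k\<close> a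
        by (intro reduce_top_set[of 2 "?S k" a]) (auto simp: lessThan_empty_iff)
    next
      case False
      \<comment> \<open>The cofactor would be 1 here. Exponents at least 2 with sum 2n are all equal
        to 2, the monomial covered by \<open>two\<close>.\<close>
      then have "k = n" "total_degree n a = 2 * n" using a(3) that by auto
      then have "(\<Sum>i\<in>{1..n}. a i) = (\<Sum>i\<in>{1..n}. 2)" by (simp add: total_degree_def)
      moreover have "2 \<le> a i" if "i \<in> {1..n}" for i using ge2 that img \<open>k = n\<close> by auto
      ultimately have "2 = a i" if "i \<in> {1..n}" for i
        using sum_mono_inv[of "\<lambda>_. 2" "{1..n}" a i] that by simp
      then have "X a = X (\<lambda>_. 2)" by (intro X_cong) simp
      then show ?thesis using two \<open>total_degree n a = 2 * n\<close> by simp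
    qed
    then show False using a(1) by simp
  qed
  have bottom: "-1 \<le> w k" if "k \<le> n" for k
    using p(2)[of "k - 1" k] that by (auto simp: w_def)
  show thesis
  proof (rule that[of w])
    show "w 0 = 1" by (simp add: w_def)
    show "w i \<in> {-1, 0, 1}" if "i \<le> n" for i
      using top[OF that] bottom[OF that] by auto
    show "int (a (p (i - 1))) = int (a (p i)) + w i + 1" if "1 \<le> i" "i < n" for i
      using that by (simp add: w_def)
    show "int (a (p (n - 1))) = w n" using \<open>2 \<le> n\<close> by (simp add: w_def)
    \<comment> \<open>For i = 0 the set is empty and the relation is that of E_0, the sum of the
      variables; the sentinel \<open>w 0 = 1\<close> stands for this case.\<close>
    show "w (Suc i) \<le> 0" if i: "Suc i \<le> n" "w i = 1" for i
    proof (rule ccontr)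
      assume "\<not> w (Suc i) \<le> 0"
      then have w1: "w (Suc i) = 1" using top[OF i(1)] by simp
      have "X a \<in> D"
      proof (rule reduce_adjacent[of "?S i" "p i"])
        show "gap n 2 (?S i) a" using i by (intro gap) auto
        show "gap n 2 (insert (p i) (?S i)) a"
          unfolding S_Suc[symmetric] using i w1 by (intro gap) auto
        show "2 * card (?S i) + 1 < total_degree n a" using i a(3) S[of i] by auto
      qed (use i w1 a S[of i] nS[of i i] ge1 in auto)
      then show False using a(1) by simp
    qed
    show "w (Suc (Suc i)) \<le> 0" if i: "Suc (Suc i) \<le> n" "w i = 1" "w (Suc i) = 0" for i
    proof (rule ccontr)
      assume "\<not> w (Suc (Suc i)) \<le> 0"
      then have w2: "w (Suc (Suc i)) = 1" using top[OF i(1)] by simp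
      have eq: "insert (p i) (insert (p (Suc i)) (?S i)) = ?S (Suc (Suc i))"
        by (auto simp: S_Suc)
      have "X a + X a \<in> D"
      proof (rule double_mem_of_close_gaps[of "?S i" "p i" "p (Suc i)"])
        show "gap n 2 (?S i) a" using i by (intro gap) auto
        show "gap n 2 (insert (p i) (insert (p (Suc i)) (?S i))) a"
          unfolding eq using i w2 by (intro gap) auto
        show "a (p i) = a (p (Suc i)) + 1" using i by (auto simp: w_def)
        show "2 * card (?S i) + 3 < total_degree n a" using i a(3) S[of i] by auto
      qed (use i w2 a S[of i] nS[of i i] nS[of "Suc i" i] ge1 inj in auto)
      then show False using half a(1) by blast
    qed
  qed
qed

end

section \<open>Characteristic 2\<close>

lemma sum_pred_double: "2 * (\<Sum>k\<in>{1..<n}. int k) = int n * (int n - 1)"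
  by (induction n) (auto simp: algebra_simps)

context monomial_span
begin

text \<open>With \<open>r = 1\<close> already a gap 2 is reducible, so a minimal exception lies
  componentwise below the staircase when sorted.\<close>

lemma char2_mem:
  assumes rel: "\<And>k b. 1 \<le> k \<Longrightarrow> 1 \<le> total_degree n b \<Longrightarrow>
      (\<Sum>S | S \<subseteq> {1..n} \<and> card S = k. X (\<lambda>i. b i + 1 * ind S i)) \<in> D"
    and "2 \<le> n" "degree_bound n < total_degree n a"
  shows "X a \<in> D"
  using assms(3)
proof (induction "sq_norm n a" arbitrary: a rule: less_induct)
  case less
  have low: "lower_mem a"
    unfolding lower_mem_def using less by auto
  obtain p where p: "bij_betw p {..<n} {1..n}" "\<And>i j. i \<le> j \<Longrightarrow> j < n \<Longrightarrow> a (p j) \<le> a (p i)"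
    using sorted_enumeration[of n a] by blast
  define u where "u = (\<lambda>k. int (a (p (k - 1))) - (if k < n then int (a (p k)) else 0))"
  show ?case
  proof (rule ccontr)
    assume a: "X a \<notin> D"
    \<comment> \<open>At k = n the bound is 0: if all exponents are positive, x_1 ... x_n can be
      split off, the degree being larger than n.\<close>
    have u: "u k \<le> of_bool (k < n)" if k: "1 \<le> k" "k \<le> n" for k
    proof (rule ccontr)
      assume *: "\<not> u k \<le> of_bool (k < n)"
      have img: "p ` {..<n} = {1..n}" "inj_on p {..<n}" using p(1) by (auto simp: bij_betw_def)
      then have S: "p ` {..<k} \<subseteq> {1..n}" "card (p ` {..<k}) = k"
        using k card_image[OF inj_on_subset[OF img(2), of "{..<k}"]] by auto
      have "gap n (1 + 1) (p ` {..<k}) a"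
        using * k by (intro gap_prefix p) (auto simp: u_def)
      moreover have "1 \<le> a i" if i: "i \<in> p ` {..<k}" for i
      proof -
        obtain j where "i = p j" "j < k" using i by blast
        then have "a (p (k - 1)) \<le> a i" using p(2)[of j "k - 1"] k by simp
        moreover have "1 \<le> a (p (k - 1))" using * by (auto simp: u_def split: if_splits)
        ultimately show ?thesis by simp
      qed
      moreover have "n < total_degree n a"
        using two_mult_le_degree_bound(1)[OF assms(2)] less.prems assms(2) by linarith
      ultimately have "X a \<in> D"
        using rel S k low by (intro reduce_top_set[of 1 "p ` {..<k}" a]) (auto simp: lessThan_empty_iff)
      then show False using a by simp
    qed
    have "int (total_degree n a) = (\<Sum>k\<in>{1..n}. int k * u k)"
      unfolding u_def by (rule total_degree_by_levels[OF p(1)])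
    also have "\<dots> \<le> (\<Sum>k\<in>{1..n}. int k * of_bool (k < n))"
      using u by (intro sum_mono mult_left_mono) auto
    also have "\<dots> = (\<Sum>k\<in>{1..<n}. int k)"
      by (rule sum.mono_neutral_cong_right) auto
    finally have "2 * int (total_degree n a) \<le> int n * (int n - 1)"
      using sum_pred_double[of n] by linarith
    then have "int (2 * total_degree n a) \<le> int (n * (n - 1))"
      using assms(2) by (simp add: of_nat_diff)
    then have "2 * total_degree n a \<le> n * (n - 1)" by (simp only: of_nat_le_iff)
    then have "total_degree n a \<le> n * (n - 1) div 2" by simp
    then show False using less.prems by linarith
  qed
qed

end

text \<open>An excess of 3 over the staircase 2, 1, 0 is what degree above 5 requires for n = 3;
  only the exponents 3, 2, 1 achieve it.\<close>

lemma excess_three: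
  fixes w :: "nat \<Rightarrow> int"
  assumes "w 0 = 1" "\<And>i. i \<le> 3 \<Longrightarrow> w i \<in> {-1, 0, 1}"
    "\<And>i. Suc i \<le> 3 \<Longrightarrow> w i = 1 \<Longrightarrow> w (Suc i) \<le> 0"
    "\<And>i. Suc (Suc i) \<le> 3 \<Longrightarrow> w i = 1 \<Longrightarrow> w (Suc i) = 0 \<Longrightarrow> w (Suc (Suc i)) \<le> 0"
    and "3 \<le> w 1 + 2 * w 2 + 3 * w 3"
  shows "w 1 = 0 \<and> w 2 = 0 \<and> w 3 = 1"
  using assms(2)[of 1] assms(2)[of 2] assms(2)[of 3] assms(1) assms(3)[of 0] assms(3)[of 2] assms(5)
  by (auto simp: numeral_eq_Suc)

section \<open>Small n and the degree bound for irreducible monomials\<close>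

lemma flags_0: "flags n 0 = Pair {} ` {1..n}"
proof -
  have "S = {}" if "S \<subseteq> {1..n}" "card S = 0" for S
    using that finite_subset[of S "{1..n}"] by simp
  then show ?thesis by (force simp: flags_def)
qed

lemma flags_1: "flags n 1 = (\<Union>s\<in>{1..n}. (\<lambda>t. ({t}, s)) ` ({1..n} - {s}))"
  by (auto simp: flags_def card_1_singleton_iff)

lemma flags_pred: "flags (Suc n) n = (\<lambda>s. ({1..Suc n} - {s}, s)) ` {1..Suc n}"
proof -
  have "flags (Suc n) n \<subseteq> (\<lambda>s. ({1..Suc n} - {s}, s)) ` {1..Suc n}"
  proof (rule subrelI)
    fix S s assume "(S, s) \<in> flags (Suc n) n"
    then have S: "S \<subseteq> {1..Suc n}" "card S = n" "s \<in> {1..Suc n}" "s \<notin> S"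
      by (simp_all add: mem_flags)
    then have "S = {1..Suc n} - {s}" by (intro card_subset_eq) auto
    then show "(S, s) \<in> (\<lambda>s. ({1..Suc n} - {s}, s)) ` {1..Suc n}"
      by (rule_tac image_eqI[of _ _ s]) (simp_all only: S)
  qed
  moreover have "(\<lambda>s. ({1..Suc n} - {s}, s)) ` {1..Suc n} \<subseteq> flags (Suc n) n"
    by (auto simp: mem_flags)
  ultimately show ?thesis by blast
qed

lemma flags_3:
  "flags 3 0 = {({}, 1), ({}, 2), ({}, 3)}"
  "flags 3 1 = {({2}, 1), ({3}, 1), ({1}, 2), ({3}, 2), ({1}, 3), ({2}, 3)}"
  "flags 3 2 = {({2, 3}, 1), ({1, 3}, 2), ({1, 2}, 3)}"
proof -
  have ivl: "{1..3} = {1, 2, 3 :: nat}" "{1..Suc 2} = {1, 2, 3 :: nat}" by auto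
  show "flags 3 0 = {({}, 1), ({}, 2), ({}, 3)}"
    "flags 3 1 = {({2}, 1), ({3}, 1), ({1}, 2), ({3}, 2), ({1}, 3), ({2}, 3)}"
    unfolding flags_0 flags_1 ivl by (simp_all add: insert_Diff_if) auto
  have "flags 3 2 = flags (Suc 2) 2" by simp
  then show "flags 3 2 = {({2, 3}, 1), ({1, 3}, 2), ({1, 2}, 3)}"
    unfolding flags_pred ivl by (simp add: insert_Diff_if)
qed

text \<open>A normal form for exponent vectors with n <= 3, so that equal monomials in different
  relations become syntactically equal. For n = 2 the last entry is set to 0.\<close>

definition vec3 :: "nat \<Rightarrow> nat \<Rightarrow> nat \<Rightarrow> nat \<Rightarrow> nat"
  where "vec3 x y z i = (if i = 1 then x else if i = 2 then y else z)"

context skew_monomial_span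
begin

lemma levels_deg:
  assumes p: "bij_betw p {..<n} {1..n}" and "1 \<le> n"
    and w: "\<And>i. 1 \<le> i \<Longrightarrow> i < n \<Longrightarrow> int (a (p (i - 1))) = int (a (p i)) + w i + 1"
    "int (a (p (n - 1))) = w n"
  shows "int (total_degree n a) = (\<Sum>k\<le>n. int k * w k) + (\<Sum>k\<in>{1..<n}. int k)"
proof -
  have "int (total_degree n a) = (\<Sum>k\<in>{1..n}. int k * (w k + of_bool (k < n)))"
    unfolding total_degree_by_levels[OF p] using w by (intro sum.cong) auto
  also have "\<dots> = (\<Sum>k\<in>{1..n}. int k * w k) + (\<Sum>k\<in>{1..n}. int k * of_bool (k < n))"
    by (simp add: distrib_left sum.distrib)
  also have "(\<Sum>k\<in>{1..n}. int k * w k) = (\<Sum>k\<le>n. int k * w k)"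
    by (rule sum.mono_neutral_cong_left) auto
  also have "(\<Sum>k\<in>{1..n}. int k * of_bool (k < n)) = (\<Sum>k\<in>{1..<n}. int k)"
    by (rule sum.mono_neutral_cong_right) auto
  finally show ?thesis .
qed

text \<open>Induction on the square norm within one degree. A minimal exception has levels subject
  to the excess bound, which contradicts its degree; for n = 3 it must be a permutation of 3, 2, 1,
  covered by \<open>three\<close>.\<close>

lemma large_degree_mem:
  assumes half: "\<And>x. x + x \<in> D \<Longrightarrow> x \<in> D" and "2 \<le> n"
    and two: "n = 2 \<or> n = 3 \<Longrightarrow> X (\<lambda>_. 2) \<in> D"
    and three: "\<And>a. n = 3 \<Longrightarrow> a ` {1..3} = {1, 2, 3} \<Longrightarrow> X a \<in> D"
    and "degree_bound n < total_degree n a"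
  shows "X a \<in> D"
  using assms(5)
proof (induction "sq_norm n a" arbitrary: a rule: less_induct)
  case less
  have low: "lower_mem a"
    unfolding lower_mem_def using less by auto
  obtain p where p: "bij_betw p {..<n} {1..n}" "\<And>i j. i \<le> j \<Longrightarrow> j < n \<Longrightarrow> a (p j) \<le> a (p i)"
    using sorted_enumeration[of n a] by blast
  show ?case
  proof (rule ccontr)
    assume a: "X a \<notin> D"
    have "2 * n - 1 < total_degree n a" "X (\<lambda>_. 2) \<in> D \<or> 2 * n < total_degree n a"
      using two_mult_le_degree_bound[OF assms(2)] less.prems two by linarith+
    then obtain w where w: "w 0 = 1" "\<And>i. i \<le> n \<Longrightarrow> w i \<in> {-1, 0, 1}"
      "\<And>i. Suc i \<le> n \<Longrightarrow> w i = 1 \<Longrightarrow> w (Suc i) \<le> 0"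
      "\<And>i. Suc (Suc i) \<le> n \<Longrightarrow> w i = 1 \<Longrightarrow> w (Suc i) = 0 \<Longrightarrow> w (Suc (Suc i)) \<le> 0"
      and lev: "\<And>i. 1 \<le> i \<Longrightarrow> i < n \<Longrightarrow> int (a (p (i - 1))) = int (a (p i)) + w i + 1"
      "int (a (p (n - 1))) = w n"
      using minimal_levels[OF half assms(2) a low _ _ p] by blast
    have d: "int (total_degree n a) = (\<Sum>k\<le>n. int k * w k) + (\<Sum>k\<in>{1..<n}. int k)"
      by (rule levels_deg[OF p(1) _ lev]) (use assms(2) in auto)
    show False
    proof (cases "n = 3")
      case False
      have "6 * int (total_degree n a) \<le> int n * (int n + 3) + 3 * int n * (int n - 1)"
        using weighted_excess_bound[of w n, OF w] sum_pred_double[of n] d by linarith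
      then have "int (total_degree n a) \<le> int (degree_bound n)"
        by (rule excess_le_degree_bound[OF assms(2) False])
      then show False using less.prems by (simp only: of_nat_le_iff)
    next
      case True
      have "w 1 = 0 \<and> w 2 = 0 \<and> w 3 = 1"
      proof (rule excess_three)
        have "{..3 :: nat} = {0, 1, 2, 3}" by auto
        then have "int (total_degree n a) = w 1 + 2 * w 2 + 3 * w 3 + 3"
          using d sum_pred_double[of 3] True by simp
        then show "3 \<le> w 1 + 2 * w 2 + 3 * w 3" using less.prems True by simp
      qed (use w True in auto)
      then have "a (p 2) = 1" "a (p 1) = 2" "a (p 0) = 3"
        using lev(1)[of 1] lev(1)[of 2] lev(2) True by (auto simp: numeral_eq_Suc)
      moreover have "{1..3} = p ` {0, 1, 2}"
        using p(1) True by (auto simp: bij_betw_def lessThan_Suc numeral_eq_Suc)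
      ultimately have "a ` {1..3} = {1, 2, 3}" by auto
      then show False using three True a by blast
    qed
  qed
qed

text \<open>E_0 x^(2,1) and E_1 x^(1,0) involve the same two monomials, with opposite relative sign,
  and add up to 2 x^(2,2).\<close>

lemma two_mem_2:
  assumes half: "\<And>x. x + x \<in> D \<Longrightarrow> x \<in> D" and n: "n = 2"
  shows "X (\<lambda>_. 2) \<in> D"
proof -
  have "{1..2} = {1, 2 :: nat}" by auto
  have flags: "flags n 0 = {({}, 1), ({}, 2)}" "flags n 1 = {({1}, 2), ({2}, 1)}"
    unfolding flags_0 flags_1 n \<open>{1..2} = {1, 2 :: nat}\<close> by (simp_all add: insert_Diff_if)
  have "{1..n} = {1, 2}" using n by auto
  then have X: "X a = X (vec3 (a 1) (a 2) 0)" for a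
    by (intro X_cong) (auto simp: vec3_def)
  have ivl: "{1..<1 :: nat} = {}" "{Suc 0..<2} = {1}" by auto
  have rel: "(\<Sum>(S, s)\<in>flags n k. (-1) ^ (\<Sum>j\<in>{1..<s}. vec3 x y 0 j) *
      X (vec3 (x + odd_vec S s 1) (y + odd_vec S s 2) 0)) \<in> D"
    if "1 \<le> x + y" for k x y
  proof -
    have "X (\<lambda>i. vec3 x y 0 i + odd_vec S s i) =
        X (vec3 (x + odd_vec S s 1) (y + odd_vec S s 2) 0)" for S s
      by (subst X) (simp add: vec3_def)
    moreover have "1 \<le> total_degree n (vec3 x y 0)"
      unfolding total_degree_def \<open>{1..n} = {1, 2}\<close> using that by (simp add: vec3_def)
    ultimately show ?thesis using odd_rel[of "vec3 x y 0" k] by simp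
  qed
  have 1: "X (vec3 3 1 0) + X (vec3 2 2 0) \<in> D"
    using rel[of 2 1 0] by (simp add: flags[unfolded One_nat_def] ivl odd_vec_def) (simp add: vec3_def numeral_2_eq_2 numeral_3_eq_3 algebra_simps)
  have 2: "- X (vec3 3 1 0) + X (vec3 2 2 0) \<in> D"
    using rel[of 1 0 1] by (simp add: flags[unfolded One_nat_def] ivl odd_vec_def) (simp add: vec3_def numeral_2_eq_2 numeral_3_eq_3 algebra_simps)
  have "X (vec3 2 2 0) + X (vec3 2 2 0) \<in> D" using add_mem[OF 1 2] by simp
  then have "X (vec3 2 2 0) \<in> D" by (rule half)
  then show ?thesis by (subst X) (simp add: vec3_def)
qed

text \<open>Linear algebra in degree 6 on x^(2,2,2) and the six permutations of x^(3,2,1). The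
  determinant obstruction is 6, whence the two divisibility hypotheses.\<close>

lemma perm_mem_3:
  assumes half: "\<And>x. x + x \<in> D \<Longrightarrow> x \<in> D" and third: "\<And>x. x + x + x \<in> D \<Longrightarrow> x \<in> D"
    and n: "n = 3"
  shows "X (\<lambda>_. 2) \<in> D" "a ` {1..3} = {1, 2, 3} \<Longrightarrow> X a \<in> D"
proof -
  have ivl: "{1..n} = {1, 2, 3}" "{1..3} = {1, 2, 3 :: nat}" using n by auto
  have X: "X a = X (vec3 (a 1) (a 2) (a 3))" for a
    by (rule X_cong, unfold ivl) (auto simp: vec3_def)
  have ivl': "{1..<1 :: nat} = {}" "{Suc 0..<2} = {1}" "{Suc 0..<3} = {1, 2}" by auto
  have rel: "(\<Sum>(S, s)\<in>flags 3 k. (-1) ^ (\<Sum>j\<in>{1..<s}. vec3 x y z j) *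
      X (vec3 (x + odd_vec S s 1) (y + odd_vec S s 2) (z + odd_vec S s 3))) \<in> D"
    if "1 \<le> x + y + z" for k x y z
  proof -
    have "X (\<lambda>i. vec3 x y z i + odd_vec S s i) =
        X (vec3 (x + odd_vec S s 1) (y + odd_vec S s 2) (z + odd_vec S s 3))" for S s
      by (subst X) (simp add: vec3_def)
    moreover have "1 \<le> total_degree n (vec3 x y z)"
      unfolding total_degree_def ivl using that by (simp add: vec3_def)
    ultimately show ?thesis using odd_rel[of "vec3 x y z" k] n by simp
  qed
  note simps = flags_3[unfolded One_nat_def] ivl' odd_vec_def
  \<comment> \<open>The arguments of \<open>rel\<close> are the cofactor exponents followed by k:
    E_0 with the permutations of (2,2,1), then E_2 with single variables, finally E_1 with
    (1,1,1).\<close>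
  have 1: "X (vec3 3 2 1) + X (vec3 2 3 1) + X (vec3 2 2 2) \<in> D"
    using rel[of 2 2 1 0] by (simp add: simps) (simp add: vec3_def numeral_2_eq_2 numeral_3_eq_3 algebra_simps)
  have 2: "X (vec3 3 1 2) + X (vec3 2 2 2) - X (vec3 2 1 3) \<in> D"
    using rel[of 2 1 2 0] by (simp add: simps) (simp add: vec3_def numeral_2_eq_2 numeral_3_eq_3 algebra_simps)
  have 3: "X (vec3 2 2 2) - X (vec3 1 3 2) - X (vec3 1 2 3) \<in> D"
    using rel[of 1 2 2 0] by (simp add: simps) (simp add: vec3_def numeral_2_eq_2 numeral_3_eq_3 algebra_simps)
  have 4: "X (vec3 2 2 2) - X (vec3 3 1 2) - X (vec3 3 2 1) \<in> D"
    using rel[of 1 0 0 2] by (simp add: simps) (simp add: vec3_def numeral_2_eq_2 numeral_3_eq_3 algebra_simps)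
  have 5: "X (vec3 1 3 2) + X (vec3 2 2 2) - X (vec3 2 3 1) \<in> D"
    using rel[of 0 1 0 2] by (simp add: simps) (simp add: vec3_def numeral_2_eq_2 numeral_3_eq_3 algebra_simps)
  have 6: "X (vec3 1 2 3) + X (vec3 2 1 3) + X (vec3 2 2 2) \<in> D"
    using rel[of 0 0 1 2] by (simp add: simps) (simp add: vec3_def numeral_2_eq_2 numeral_3_eq_3 algebra_simps)
  have 7: "X (vec3 2 3 1) + X (vec3 2 1 3) - X (vec3 3 2 1) - X (vec3 1 2 3)
      + X (vec3 3 1 2) + X (vec3 1 3 2) \<in> D"
    using rel[of 1 1 1 1] by (simp add: simps) (simp add: vec3_def numeral_2_eq_2 numeral_3_eq_3 algebra_simps)
  let ?W = "X (vec3 2 2 2)"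
  \<comment> \<open>In the sum of the first six relations each permutation of (3,2,1) occurs once
    with each sign.\<close>
  have "(?W + ?W) + (?W + ?W) + (?W + ?W) \<in> D"
    using add_mem[OF add_mem[OF add_mem[OF 1 2] add_mem[OF 3 4]] add_mem[OF 5 6]]
    by (simp add: algebra_simps)
  then have W: "?W \<in> D" using half third by blast
  then show "X (\<lambda>_. 2) \<in> D" by (subst X)
  have r1: "X (vec3 3 2 1) + X (vec3 2 3 1) \<in> D"
    using diff_mem[OF 1 W] by (simp add: algebra_simps)
  have r2: "X (vec3 3 1 2) - X (vec3 2 1 3) \<in> D"
    using diff_mem[OF 2 W] by (simp add: algebra_simps)
  have r3: "X (vec3 1 3 2) + X (vec3 1 2 3) \<in> D"
    using diff_mem[OF W 3] by (simp add: algebra_simps)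
  have r4: "X (vec3 3 1 2) + X (vec3 3 2 1) \<in> D"
    using diff_mem[OF W 4] by (simp add: algebra_simps)
  have r5: "X (vec3 1 3 2) - X (vec3 2 3 1) \<in> D"
    using diff_mem[OF 5 W] by (simp add: algebra_simps)
  let ?A = "X (vec3 3 2 1)"
  \<comment> \<open>Modulo \<open>D\<close> the relations r1 to r5 make all six monomials equal to
    \<open>?A\<close> up to sign, and relation 7 then reads -6 \<open>?A\<close>.\<close>
  have "(?A + ?A) + (?A + ?A) + (?A + ?A) \<in> D"
    using diff_mem[OF add_mem[OF add_mem[OF add_mem[OF add_mem[OF r1 r1] r1] add_mem[OF r4 r4]] add_mem[OF r5 r5]]
      add_mem[OF add_mem[OF 7 r2] r3]]
    by (simp add: algebra_simps)
  then have A: "?A \<in> D" using half third by blast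
  have B: "X (vec3 2 3 1) \<in> D" using diff_mem[OF r1 A] by simp
  have C: "X (vec3 3 1 2) \<in> D" using diff_mem[OF r4 A] by simp
  have D: "X (vec3 2 1 3) \<in> D" using diff_mem[OF C r2] by simp
  have E: "X (vec3 1 3 2) \<in> D" using add_mem[OF r5 B] by simp
  have F: "X (vec3 1 2 3) \<in> D" using diff_mem[OF r3 E] by simp
  assume "a ` {1..3} = {1, 2, 3}"
  then have "{a 1, a 2, a 3} = {1, 2, 3}" by (simp only: ivl image_insert image_empty)
  then have vals: "a 1 \<in> {1, 2, 3}" "a 2 \<in> {1, 2, 3}" "a 3 \<in> {1, 2, 3}"
    "1 \<in> {a 1, a 2, a 3} \<and> 2 \<in> {a 1, a 2, a 3} \<and> 3 \<in> {a 1, a 2, a 3}" by blast+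
  have "(x, y, z) \<in> {(3, 2, 1), (2, 3, 1), (3, 1, 2), (2, 1, 3), (1, 3, 2), (1, 2, 3)}"
    if "x \<in> {1, 2, 3}" "y \<in> {1, 2, 3}" "z \<in> {1, 2, 3}"
      "1 \<in> {x, y, z} \<and> 2 \<in> {x, y, z} \<and> 3 \<in> {x, y, z}" for x y z :: nat
    using that by (elim insertE emptyE) simp_all
  from this[OF vals] have "X (vec3 (a 1) (a 2) (a 3)) \<in> D"
    using A B C D E F by (elim insertE emptyE) auto
  then show "X a \<in> D" by (subst X)
qed

end

section \<open>Monomials modulo the skew relations\<close>

lemma free_algebra_closed:
  fixes f g :: "'k::field nc_poly"
  shows "f \<in> carrier (free_algebra n) \<Longrightarrow> g \<in> carrier (free_algebra n) \<Longrightarrow> f + g \<in> carrier (free_algebra n)"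
    "f \<in> carrier (free_algebra n) \<Longrightarrow> g \<in> carrier (free_algebra n) \<Longrightarrow> f * g \<in> carrier (free_algebra n)"
    "f \<in> carrier (free_algebra n) \<Longrightarrow> - f \<in> carrier (free_algebra n)"
    "(0 :: 'k nc_poly) \<in> carrier (free_algebra n)" "(1 :: 'k nc_poly) \<in> carrier (free_algebra n)"
proof -
  interpret ring "free_algebra n :: 'k nc_poly ring" by (rule ring_free_algebra)
  show "f \<in> carrier (free_algebra n) \<Longrightarrow> g \<in> carrier (free_algebra n) \<Longrightarrow> f + g \<in> carrier (free_algebra n)"
    "f \<in> carrier (free_algebra n) \<Longrightarrow> g \<in> carrier (free_algebra n) \<Longrightarrow> f * g \<in> carrier (free_algebra n)"
    "(0 :: 'k nc_poly) \<in> carrier (free_algebra n)" "(1 :: 'k nc_poly) \<in> carrier (free_algebra n)"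
    using a_closed[of f g] m_closed[of f g] zero_closed one_closed
    by (simp_all only: free_algebra_simps)
  show "f \<in> carrier (free_algebra n) \<Longrightarrow> - f \<in> carrier (free_algebra n)"
    by (simp add: free_algebra_def)
qed

lemma free_algebra_sum:
  "(\<And>j. j \<in> J \<Longrightarrow> f j \<in> carrier (free_algebra n)) \<Longrightarrow> sum f J \<in> carrier (free_algebra n)"
  by (induction J rule: infinite_finite_induct) (auto intro: free_algebra_closed)

lemma skew_ideal_closed:
  fixes f g c :: "'k::field nc_poly"
  shows "f \<in> skew_ideal n \<Longrightarrow> g \<in> skew_ideal n \<Longrightarrow> f + g \<in> skew_ideal n"
    "c \<in> carrier (free_algebra n) \<Longrightarrow> f \<in> skew_ideal n \<Longrightarrow> c * f \<in> skew_ideal n"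
    "c \<in> carrier (free_algebra n) \<Longrightarrow> f \<in> skew_ideal n \<Longrightarrow> f * c \<in> skew_ideal n"
    "(0 :: 'k nc_poly) \<in> skew_ideal n"
proof -
  interpret ideal "skew_ideal n :: 'k nc_poly set" "free_algebra n" by (rule ideal_skew_ideal)
  show "f \<in> skew_ideal n \<Longrightarrow> g \<in> skew_ideal n \<Longrightarrow> f + g \<in> skew_ideal n"
    "c \<in> carrier (free_algebra n) \<Longrightarrow> f \<in> skew_ideal n \<Longrightarrow> c * f \<in> skew_ideal n"
    "c \<in> carrier (free_algebra n) \<Longrightarrow> f \<in> skew_ideal n \<Longrightarrow> f * c \<in> skew_ideal n"
    "(0 :: 'k nc_poly) \<in> skew_ideal n"
    using additive_subgroup.a_closed[OF additive_subgroup_axioms, of f g]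
      I_l_closed[of f c] I_r_closed[of f c] additive_subgroup.zero_closed[OF additive_subgroup_axioms]
    by (simp_all only: free_algebra_simps)
qed

lemma skew_ideal_uminus: "f \<in> skew_ideal n \<Longrightarrow> - f \<in> skew_ideal n"
  using skew_ideal_closed(2)[OF free_algebra_closed(3)[OF free_algebra_closed(5)], of f n] by simp

lemma skew_ideal_sum: "(\<And>j. j \<in> J \<Longrightarrow> f j \<in> skew_ideal n) \<Longrightarrow> sum f J \<in> skew_ideal n"
  by (induction J rule: infinite_finite_induct) (auto intro: skew_ideal_closed)

text \<open>Congruence of representatives: computations with signs stay in the ring type of free
  polynomials instead of the ring of cosets.\<close>

definition skew_cong :: "nat \<Rightarrow> 'k::field nc_poly \<Rightarrow> 'k nc_poly \<Rightarrow> bool"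
  where "skew_cong n f g \<longleftrightarrow> f - g \<in> skew_ideal n"

lemma skew_cong_refl [simp]: "skew_cong n f f"
  by (simp add: skew_cong_def skew_ideal_closed)

lemma skew_cong_trans [trans]: "skew_cong n f g \<Longrightarrow> skew_cong n g h \<Longrightarrow> skew_cong n f h"
  using skew_ideal_closed(1)[of "f - g" n "g - h"] by (simp add: skew_cong_def)

lemma skew_cong_sym: "skew_cong n f g \<Longrightarrow> skew_cong n g f"
  using skew_ideal_uminus[of "f - g" n] by (simp add: skew_cong_def)

lemma skew_cong_mult_left:
  "c \<in> carrier (free_algebra n) \<Longrightarrow> skew_cong n f g \<Longrightarrow> skew_cong n (c * f) (c * g)"
  using skew_ideal_closed(2)[of c n "f - g"] by (simp add: skew_cong_def algebra_simps)

lemma skew_cong_mult_right: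
  "c \<in> carrier (free_algebra n) \<Longrightarrow> skew_cong n f g \<Longrightarrow> skew_cong n (f * c) (g * c)"
  using skew_ideal_closed(3)[of c n "f - g"] by (simp add: skew_cong_def algebra_simps)

lemma skew_cong_sum:
  "(\<And>j. j \<in> J \<Longrightarrow> skew_cong n (f j) (g j)) \<Longrightarrow> skew_cong n (sum f J) (sum g J)"
  unfolding skew_cong_def sum_subtractf[symmetric] by (rule skew_ideal_sum)

definition word_poly :: "nat list \<Rightarrow> 'k::field nc_poly"
  where "word_poly w = Poly_Mapping.single (Word w) 1"

lemma word_poly_append: "word_poly (v @ w) = word_poly v * word_poly w"
  by (simp add: word_poly_def mult_single plus_free_monoid_def)

lemma word_poly_Cons: "word_poly (x # w) = word_poly [x] * word_poly w"
  using word_poly_append[of "[x]" w] by simp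

lemma word_poly_carrier: "set w \<subseteq> {1..n} \<Longrightarrow> word_poly w \<in> carrier (free_algebra n)"
  by (simp add: word_poly_def free_algebra_def)

lemma sign_carrier: "(-1) ^ k \<in> carrier (free_algebra n)"
  by (cases "even k") (auto intro: free_algebra_closed)

lemma sign_commute: "(-1) ^ k * f = f * (-1) ^ k" for f :: "'a :: ring_1"
  by (cases "even k") auto

lemma skew_cong_swap:
  assumes "x \<in> {1..n}" "y \<in> {1..n}" "x \<noteq> y"
  shows "skew_cong n (word_poly [x, y]) (- word_poly [y, x] :: 'k::field nc_poly)"
proof -
  have "gen_var x * gen_var y + gen_var y * gen_var x \<in> (skew_relations n :: 'k nc_poly set)"
    using assms by (auto simp: skew_relations_def)
  then have "gen_var x * gen_var y + gen_var y * gen_var x \<in> (skew_ideal n :: 'k nc_poly set)"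
    unfolding skew_ideal_def
    using ring.genideal_self[OF ring_free_algebra skew_relations_carrier] by blast
  then show ?thesis
    by (simp add: skew_cong_def word_poly_def gen_var_def mult_single plus_free_monoid_def)
qed

lemma skew_cong_move:
  assumes "x \<in> {1..n}" "x \<notin> set v" "set v \<subseteq> {1..n}" "set u \<subseteq> {1..n}"
  shows "skew_cong n (word_poly (x # v @ u)) ((-1) ^ length v * word_poly (v @ x # u) :: 'k::field nc_poly)"
  using assms(2,3)
proof (induction v)
  case (Cons y v)
  have "skew_cong n (word_poly [x, y] * word_poly (v @ u))
      (- word_poly [y, x] * word_poly (v @ u) :: 'k nc_poly)"
    using Cons.prems assms by (intro skew_cong_mult_right skew_cong_swap word_poly_carrier) auto
  then have "skew_cong n (word_poly (x # (y # v) @ u))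
      (- (word_poly [y] * word_poly (x # v @ u)) :: 'k nc_poly)"
    by (simp flip: word_poly_append)
  also have "\<dots> = - word_poly [y] * word_poly (x # v @ u)" by simp
  also have "skew_cong n \<dots> (- word_poly [y] * ((-1) ^ length v * word_poly (v @ x # u)))"
  proof (rule skew_cong_mult_left)
    show "skew_cong n (word_poly (x # v @ u)) ((-1) ^ length v * word_poly (v @ x # u) :: 'k nc_poly)"
      using Cons.prems by (intro Cons.IH) auto
    show "- word_poly [y] \<in> carrier (free_algebra n)"
      using Cons.prems by (intro free_algebra_closed(3) word_poly_carrier) auto
  qed
  also have "- word_poly [y] * ((-1) ^ length v * word_poly (v @ x # u)) =
      (-1) ^ length (y # v) * word_poly ((y # v) @ x # u)"
    by (cases "even (length v)") (simp_all flip: word_poly_append)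
  finally show ?case .
qed simp

section \<open>Sorted monomials and signs\<close>

definition sorted_word :: "nat \<Rightarrow> (nat \<Rightarrow> nat) \<Rightarrow> nat list"
  where "sorted_word n a = concat (map (\<lambda>i. replicate (a i) i) [1..<Suc n])"

definition mono_poly :: "nat \<Rightarrow> (nat \<Rightarrow> nat) \<Rightarrow> 'k::field nc_poly"
  where "mono_poly n a = word_poly (sorted_word n a)"

lemma set_sorted_word: "set (sorted_word n a) \<subseteq> {1..n}"
  by (auto simp: sorted_word_def)

lemma mono_poly_carrier: "mono_poly n a \<in> carrier (free_algebra n)"
  unfolding mono_poly_def by (intro word_poly_carrier set_sorted_word)

lemma mono_poly_cong: "(\<And>i. i \<in> {1..n} \<Longrightarrow> a i = b i) \<Longrightarrow> mono_poly n a = mono_poly n b"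
  unfolding mono_poly_def sorted_word_def by (auto intro!: arg_cong[of _ _ concat] arg_cong[of _ _ word_poly])

lemma length_blocks: "length (concat (map (\<lambda>i. replicate (a i) (f i)) [x..<y])) = sum a {x..<y}"
  by (simp add: length_concat o_def sum_list_distinct_conv_sum_set)

lemma count_sorted_word: "i \<in> {1..n} \<Longrightarrow> count_list (sorted_word n a) i = a i"
proof (induction n)
  case (Suc n)
  have "count_list (replicate k j) i = (if i = j then k else 0)" for k j by (induction k) auto
  moreover have "count_list (sorted_word n a) i = 0" if "i = Suc n"
    using set_sorted_word[of n a] that by (intro count_notin) auto
  moreover have "sorted_word (Suc n) a = sorted_word n a @ replicate (a (Suc n)) (Suc n)"
    by (simp add: sorted_word_def)
  ultimately show ?case using Suc by (cases "i = Suc n") auto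
qed simp

lemma sorted_sorted_word: "sorted (sorted_word n a)"
proof (induction n)
  case (Suc n)
  moreover have "sorted_word (Suc n) a = sorted_word n a @ replicate (a (Suc n)) (Suc n)"
    by (simp add: sorted_word_def)
  ultimately show ?case
    using set_sorted_word[of n a] by (fastforce simp: sorted_append)
qed (simp add: sorted_word_def)

text \<open>The new letter passes only the smaller letters and stops in front of its own block, so
  it never has to be exchanged with itself.\<close>

lemma skew_cong_insert:
  assumes x: "x \<in> {1..n}"
  shows "skew_cong n (word_poly [x] * mono_poly n a)
    ((-1) ^ (\<Sum>j\<in>{1..<x}. a j) * mono_poly n (a(x := Suc (a x))) :: 'k::field nc_poly)"
proof -
  define pre where "pre = concat (map (\<lambda>i. replicate (a i) i) [1..<x])"
  define post where "post = concat (map (\<lambda>i. replicate (a i) i) [Suc x..<Suc n])"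
  have split: "[1..<Suc n] = [1..<x] @ x # [Suc x..<Suc n]"
    using x upt_add_eq_append[of 1 x "Suc n - x"] upt_conv_Cons[of x "Suc n"] by simp
  have a: "sorted_word n a = pre @ replicate (a x) x @ post"
    by (simp only: sorted_word_def split pre_def post_def) simp
  have upd: "map (\<lambda>i. replicate ((a(x := Suc (a x))) i) i) [1..<x] = map (\<lambda>i. replicate (a i) i) [1..<x]"
    "map (\<lambda>i. replicate ((a(x := Suc (a x))) i) i) [Suc x..<Suc n] =
      map (\<lambda>i. replicate (a i) i) [Suc x..<Suc n]"
    by (auto simp del: upt_Suc)
  have a': "sorted_word n (a(x := Suc (a x))) = pre @ x # replicate (a x) x @ post"
    unfolding sorted_word_def split map_append list.map upd pre_def post_def by (simp del: upt_Suc)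
  have "skew_cong n (word_poly (x # pre @ replicate (a x) x @ post))
      ((-1) ^ length pre * word_poly (pre @ x # replicate (a x) x @ post) :: 'k nc_poly)"
  proof (rule skew_cong_move[OF x])
    show "x \<notin> set pre" "set pre \<subseteq> {1..n}" "set (replicate (a x) x @ post) \<subseteq> {1..n}"
      using x by (auto simp: pre_def post_def simp del: upt_Suc)
  qed
  moreover have "length pre = (\<Sum>j\<in>{1..<x}. a j)"
    unfolding pre_def by (rule length_blocks)
  ultimately show ?thesis
    by (simp add: mono_poly_def a a' flip: word_poly_Cons)
qed

text \<open>Pairs with the larger letter first. Equal letters do not count, and letters are taken to
  be at least 1.\<close>

fun inversions :: "nat list \<Rightarrow> nat"
  where "inversions [] = 0"
  | "inversions (x # w) = inversions w + (\<Sum>j\<in>{1..<x}. count_list w j)"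

lemma skew_cong_normal_form:
  "set w \<subseteq> {1..n} \<Longrightarrow>
    skew_cong n (word_poly w) ((-1) ^ inversions w * mono_poly n (count_list w) :: 'k::field nc_poly)"
proof (induction w)
  case Nil
  have "sorted_word n (count_list []) = []"
    by (auto simp: sorted_word_def concat_eq_Nil_conv simp del: upt_Suc)
  then have "mono_poly n (count_list []) = (word_poly [] :: 'k nc_poly)"
    by (simp only: mono_poly_def)
  then show ?case by (simp only: inversions.simps power_0 mult_1 skew_cong_refl)
next
  case (Cons x w)
  let ?k = "\<Sum>j\<in>{1..<x}. count_list w j"
  have x: "x \<in> {1..n}" using Cons.prems by simp
  have "skew_cong n (word_poly [x] * word_poly w)
      (word_poly [x] * ((-1) ^ inversions w * mono_poly n (count_list w)) :: 'k nc_poly)"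
    using Cons by (intro skew_cong_mult_left word_poly_carrier Cons.IH) auto
  also have "\<dots> = (-1) ^ inversions w * (word_poly [x] * mono_poly n (count_list w))"
    by (simp add: sign_commute mult.assoc flip: mult.assoc[of "word_poly [x]" "(-1) ^ inversions w"])
  also have "skew_cong n \<dots> ((-1) ^ inversions w * ((-1) ^ ?k *
      mono_poly n ((count_list w)(x := Suc (count_list w x)))))"
    by (intro skew_cong_mult_left skew_cong_insert x sign_carrier)
  also have "(count_list w)(x := Suc (count_list w x)) = count_list (x # w)" by auto
  finally show ?case by (simp add: power_add mult.assoc flip: word_poly_Cons)
qed

lemma inversions_append:
  "inversions (v @ w) = inversions v + inversions w + (\<Sum>x\<leftarrow>v. \<Sum>j\<in>{1..<x}. count_list w j)"
  by (induction v) (simp_all add: count_list_append sum.distrib)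

lemma inversions_sorted: "sorted w \<Longrightarrow> inversions w = 0"
  by (induction w) (force intro!: sum.neutral count_notin)+

lemma sum_list_sorted_word: "(\<Sum>x\<leftarrow>sorted_word n c. h x) = (\<Sum>x\<in>{1..n}. c x * h x)" for h :: "nat \<Rightarrow> nat"
proof (induction n)
  case (Suc n)
  have "sorted_word (Suc n) c = sorted_word n c @ replicate (c (Suc n)) (Suc n)"
    by (simp add: sorted_word_def)
  then show ?case using Suc by (simp add: sum_list_replicate)
qed (simp add: sorted_word_def)

text \<open>Both factors are sorted, so inversions occur only between a letter of the first factor
  and a smaller letter of the second.\<close>

lemma mono_poly_mult:
  "skew_cong n (mono_poly n c * mono_poly n b)
    ((-1) ^ (\<Sum>x\<in>{1..n}. c x * (\<Sum>j\<in>{1..<x}. b j)) * mono_poly n (\<lambda>i. b i + c i) :: 'k::field nc_poly)"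
proof -
  let ?v = "sorted_word n c" and ?w = "sorted_word n b"
  have "inversions (?v @ ?w) = (\<Sum>x\<in>{1..n}. c x * (\<Sum>j\<in>{1..<x}. count_list ?w j))"
    by (simp add: inversions_append inversions_sorted sorted_sorted_word sum_list_sorted_word)
  also have "\<dots> = (\<Sum>x\<in>{1..n}. c x * (\<Sum>j\<in>{1..<x}. b j))"
    by (intro sum.cong arg_cong2[of _ _ _ _ "(*)"] refl count_sorted_word) auto
  finally have inv: "inversions (?v @ ?w) = \<dots>" .
  have mono: "mono_poly n (count_list (?v @ ?w)) = (mono_poly n (\<lambda>i. b i + c i) :: 'k nc_poly)"
    by (intro mono_poly_cong) (simp add: count_list_append count_sorted_word del: One_nat_def)
  have "skew_cong n (word_poly (?v @ ?w))
      ((-1) ^ inversions (?v @ ?w) * mono_poly n (count_list (?v @ ?w)) :: 'k nc_poly)"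
    using set_sorted_word[of n c] set_sorted_word[of n b] by (intro skew_cong_normal_form) auto
  then show ?thesis
    unfolding inv mono by (simp only: mono_poly_def word_poly_append)
qed

lemma even_count_blocks:
  "(\<And>i. i \<in> set is \<Longrightarrow> even (c i)) \<Longrightarrow> even (count_list (concat (map (\<lambda>i. replicate (c i) (f i)) is)) j)"
proof (induction "is")
  case (Cons i "is")
  have "count_list (replicate k x) j = (if x = j then k else 0)" for k x by (induction k) auto
  then show ?case using Cons by (simp add: count_list_append)
qed simp

text \<open>Two blocks contribute either no inversion or the product of their lengths, which is even
  because at most one length is odd.\<close>

lemma even_inversions_blocks:
  assumes "distinct is" "\<And>i j. i \<in> set is \<Longrightarrow> j \<in> set is \<Longrightarrow> i \<noteq> j \<Longrightarrow> even (c i) \<or> even (c j)"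
  shows "even (inversions (concat (map (\<lambda>i. replicate (c i) (f i)) is)))"
  using assms
proof (induction "is")
  case (Cons i "is")
  let ?w = "concat (map (\<lambda>i. replicate (c i) (f i)) is)"
  have "inversions (replicate m y @ w) = inversions w + m * (\<Sum>j\<in>{1..<y}. count_list w j)" for m y w
  proof (induction m)
    case (Suc m)
    have "count_list (replicate m y) j = 0" if "j \<in> {1..<y}" for j
      using that by (intro count_notin) auto
    then show ?case using Suc by (simp add: count_list_append)
  qed simp
  moreover have "even (c i * (\<Sum>j\<in>{1..<f i}. count_list ?w j))"
  proof (cases "even (c i)")
    case False
    then have "even (c j)" if "j \<in> set is" for j
      using Cons.prems(1) Cons.prems(2)[of i j] that by auto
    then have "even (\<Sum>j\<in>{1..<f i}. count_list ?w j)"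
      by (intro dvd_sum even_count_blocks) auto
    then show ?thesis by simp
  qed simp
  moreover have "even (inversions ?w)" using Cons by auto
  ultimately show ?case by simp
qed simp

text \<open>Renaming permutes the blocks of equal letters. With at most one odd block, or with -1 =
  1, sorting them again costs no sign; this is why the terms of e_k and E_k can be summed without
  signs to give invariants.\<close>

lemma rename_mono_poly:
  assumes \<sigma>: "\<sigma> permutes {1..n}"
    and even: "(-1 :: 'k::field nc_poly) = 1 \<or>
      (\<forall>i\<in>{1..n}. \<forall>j\<in>{1..n}. i \<noteq> j \<longrightarrow> even (c i) \<or> even (c j))"
  shows "skew_cong n (rename_vars \<sigma> (mono_poly n c)) (mono_poly n (c \<circ> inv_into UNIV \<sigma>) :: 'k nc_poly)"
proof -
  let ?w = "concat (map (\<lambda>i. replicate (c i) (\<sigma> i)) [1..<Suc n])"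
  have map: "map \<sigma> (sorted_word n c) = ?w"
    by (simp add: sorted_word_def map_concat o_def)
  have w: "set (map \<sigma> (sorted_word n c)) \<subseteq> {1..n}"
    using set_sorted_word[of n c] permutes_in_image[OF \<sigma>] by auto
  have sign: "(-1 :: 'k nc_poly) ^ inversions ?w = 1"
    using even
  proof
    assume *: "\<forall>i\<in>{1..n}. \<forall>j\<in>{1..n}. i \<noteq> j \<longrightarrow> even (c i) \<or> even (c j)"
    have "even (inversions ?w)"
    proof (rule even_inversions_blocks)
      fix i j assume "i \<in> set [1..<Suc n]" "j \<in> set [1..<Suc n]" "i \<noteq> j"
      then show "even (c i) \<or> even (c j)" using * by (auto simp del: upt_Suc)
    qed simp
    then show ?thesis by simp
  qed (metis power_one)
  have "count_list ?w i = (c \<circ> inv_into UNIV \<sigma>) i" if i: "i \<in> {1..n}" for i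
  proof -
    define j where "j = inv_into UNIV \<sigma> i"
    have j: "\<sigma> j = i" "j \<in> {1..n}"
      using permutes_inverses(1)[OF \<sigma>] permutes_in_image[OF permutes_inv[OF \<sigma>]] i
      by (auto simp: j_def)
    have "count_list (map \<sigma> w) (\<sigma> j) = count_list w j" for w
      by (induction w) (auto simp: inj_eq[OF permutes_inj[OF \<sigma>]])
    then have "count_list ?w (\<sigma> j) = count_list (sorted_word n c) j"
      unfolding map[symmetric] by blast
    then show ?thesis using j count_sorted_word[of j n c] by (simp add: j_def)
  qed
  then have "mono_poly n (count_list ?w) = (mono_poly n (c \<circ> inv_into UNIV \<sigma>) :: 'k nc_poly)"
    by (intro mono_poly_cong)
  moreover have "rename_vars \<sigma> (mono_poly n c) = (word_poly ?w :: 'k nc_poly)"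
    by (simp only: mono_poly_def word_poly_def rename_vars_single free_monoid.map map)
  moreover have "skew_cong n (word_poly ?w)
      ((-1) ^ inversions ?w * mono_poly n (count_list ?w) :: 'k nc_poly)"
    using skew_cong_normal_form[OF w] unfolding map .
  ultimately show ?thesis using sign by (simp only: mult_1)
qed

section \<open>Decomposable elements\<close>

text \<open>Embeds the field as constant polynomials; being central, they provide the vector space
  structure inside ring multiplication.\<close>

definition scalar :: "'k::field \<Rightarrow> 'k nc_poly"
  where "scalar c = Poly_Mapping.single 0 c"

lemma scalar_simps: "scalar (c + d) = scalar c + scalar d" "scalar (c * d) = scalar c * scalar d"
  "scalar 1 = 1" "scalar 0 = 0" "scalar (- c) = - scalar c"
  by (simp_all add: scalar_def single_add mult_single single_uminus)

lemma scalar_of_nat: "scalar (of_nat m) = of_nat m"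
  by (induction m) (simp_all add: scalar_simps)

lemma scalar_commute: "scalar c * f = f * scalar c"
proof -
  have "scalar c * (\<Sum>w\<in>Poly_Mapping.keys f. Poly_Mapping.single w (Poly_Mapping.lookup f w)) =
    (\<Sum>w\<in>Poly_Mapping.keys f. Poly_Mapping.single w (Poly_Mapping.lookup f w)) * scalar c"
    by (simp add: scalar_def sum_distrib_left sum_distrib_right mult_single mult.commute)
  then show ?thesis by (simp flip: nc_poly_sum_singles)
qed

lemma scalar_carrier: "scalar c \<in> carrier (free_algebra n)"
  by (simp add: scalar_def free_algebra_def zero_free_monoid_def)

lemma rename_scalar: "rename_vars \<sigma> (scalar c * f) = scalar c * rename_vars \<sigma> f"
  by (simp add: scalar_def rename_vars_mult zero_free_monoid_def)

lemma homogeneous_mult: "homogeneous d f \<Longrightarrow> homogeneous e g \<Longrightarrow> homogeneous (d + e) (f * g)"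
  using Poly_Mapping.keys_mult[of f g] by (fastforce simp: homogeneous_def plus_free_monoid_def)

lemma homogeneous_scalar_mult: "homogeneous d f \<Longrightarrow> homogeneous d (scalar c * f)"
  using homogeneous_mult[of 0 "scalar c" d f]
  by (simp add: homogeneous_def scalar_def zero_free_monoid_def)

lemma homogeneous_sum: "(\<And>j. j \<in> J \<Longrightarrow> homogeneous d (f j)) \<Longrightarrow> homogeneous d (sum f J)"
  using Poly_Mapping.keys_sum[of f J] by (fastforce simp: homogeneous_def)

lemma homogeneous_rename:
  assumes "homogeneous d f"
  shows "homogeneous d (rename_vars \<sigma> f)"
  unfolding rename_vars_def
proof (rule homogeneous_sum)
  fix w assume "w \<in> Poly_Mapping.keys f"
  then show "homogeneous d (Poly_Mapping.single (map_free_monoid \<sigma> w) (Poly_Mapping.lookup f w))"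
    using assms by (cases w) (auto simp: homogeneous_def)
qed

lemma homogeneous_mono: "homogeneous (total_degree n a) (mono_poly n a)"
  by (simp add: homogeneous_def mono_poly_def word_poly_def sorted_word_def total_degree_def length_blocks
    atLeastLessThanSuc_atLeastAtMost del: upt_Suc)

section \<open>Residue classes and averages over G\<close>

lemma skew_class_alt: "skew_class n f = (\<lambda>h. h + f) ` skew_ideal n"
  by (auto simp: skew_class_def a_r_coset_def' free_algebra_simps)

lemma skew_class_eq_iff: "skew_class n f = skew_class n g \<longleftrightarrow> skew_cong n f g"
proof
  assume "skew_class n f = skew_class n g"
  moreover have "f \<in> skew_class n f"
    unfolding skew_class_alt by (rule image_eqI[of _ _ 0]) (simp_all add: skew_ideal_closed)
  ultimately obtain h where "h \<in> skew_ideal n" "f = h + g" by (auto simp: skew_class_alt)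
  then show "skew_cong n f g" by (simp add: skew_cong_def)
next
  have sub: "skew_class n f \<subseteq> skew_class n g" if "skew_cong n f g" for f g :: "'a nc_poly"
  proof
    fix x assume "x \<in> skew_class n f"
    then obtain h where h: "h \<in> skew_ideal n" "x = h + f" by (auto simp: skew_class_alt)
    then show "x \<in> skew_class n g"
      unfolding skew_class_alt using that
      by (intro image_eqI[of _ _ "h + (f - g)"]) (simp_all add: skew_cong_def skew_ideal_closed)
  qed
  assume "skew_cong n f g"
  then show "skew_class n f = skew_class n g" using sub skew_cong_sym by blast
qed

lemma skew_class_add:
  "f \<in> carrier (free_algebra n) \<Longrightarrow> g \<in> carrier (free_algebra n) \<Longrightarrow>
    skew_class n (f + g) = skew_class n f \<oplus>\<^bsub>skew_poly_ring n\<^esub> skew_class n g"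
  using ring_hom_add[OF skew_class_hom[of n], of f g] by (simp add: free_algebra_simps)

lemma skew_class_mult:
  "f \<in> carrier (free_algebra n) \<Longrightarrow> g \<in> carrier (free_algebra n) \<Longrightarrow>
    skew_class n (f * g) = skew_class n f \<otimes>\<^bsub>skew_poly_ring n\<^esub> skew_class n g"
  using ring_hom_mult[OF skew_class_hom[of n], of f g] by (simp add: free_algebra_simps)

lemma invariant_ring_simps:
  "f \<otimes>\<^bsub>invariant_ring n G\<^esub> g = f \<otimes>\<^bsub>skew_poly_ring n\<^esub> g"
  "f \<oplus>\<^bsub>invariant_ring n G\<^esub> g = f \<oplus>\<^bsub>skew_poly_ring n\<^esub> g"
  "\<zero>\<^bsub>invariant_ring n G\<^esub> = \<zero>\<^bsub>skew_poly_ring n\<^esub>"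
  by (simp_all add: invariant_ring_def)

abbreviation decomp_square :: "nat \<Rightarrow> (nat \<Rightarrow> nat) set \<Rightarrow> 'k::field nc_poly set set"
  where "decomp_square n G \<equiv> irrelevant_square (invariant_ring n G) (invariant_component n G)"

text \<open>The sum over the group without the factor 1/|G|; the division takes place once, in
  \<open>component_subset_square\<close>.\<close>

definition reynolds :: "(nat \<Rightarrow> nat) set \<Rightarrow> 'k::field nc_poly \<Rightarrow> 'k nc_poly"
  where "reynolds G f = (\<Sum>\<sigma>\<in>G. rename_vars \<sigma> f)"

text \<open>
  Quantifying over the scalar multiples makes this a subspace without having to know that
  \<^const>\<open>irrelevant_square\<close> is closed under scalars.
\<close>

definition decomposable :: "nat \<Rightarrow> (nat \<Rightarrow> nat) set \<Rightarrow> 'k::field nc_poly set"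
  where "decomposable n G = {f \<in> carrier (free_algebra n).
    \<forall>c. skew_class n (reynolds G (scalar c * f)) \<in> decomp_square n G}"

locale perm_group =
  fixes n :: nat and G :: "(nat \<Rightarrow> nat) set"
  assumes subgroup: "subgroup G (sym_group n)"
begin

lemma G_permutes: "\<sigma> \<in> G \<Longrightarrow> \<sigma> permutes {1..n}"
  using subgroup.subset[OF subgroup] by (auto simp: sym_group_carrier)

lemma finite_G: "finite G"
  by (rule finite_subset[OF _ finite_permutations[of "{1..n}"]]) (use G_permutes in blast)+

lemma G_comp: "\<sigma> \<in> G \<Longrightarrow> \<tau> \<in> G \<Longrightarrow> \<sigma> \<circ> \<tau> \<in> G"
  using subgroup.m_closed[OF subgroup] by (simp add: sym_group_mult)

lemma id_in_G: "id \<in> G"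
  using subgroup.one_closed[OF subgroup] by (simp add: sym_group_one)

lemma rename_carrier:
  "\<sigma> \<in> G \<Longrightarrow> f \<in> carrier (free_algebra n) \<Longrightarrow> rename_vars \<sigma> f \<in> carrier (free_algebra n)"
  by (intro rename_vars_carrier G_permutes)

lemma reynolds_carrier:
  "f \<in> carrier (free_algebra n) \<Longrightarrow> reynolds G f \<in> carrier (free_algebra n)"
  unfolding reynolds_def by (intro free_algebra_sum rename_carrier)

lemma reynolds_add: "reynolds G (f + g) = reynolds G f + reynolds G g"
  by (simp add: reynolds_def rename_vars_add sum.distrib)

lemma rename_reynolds:
  assumes "\<tau> \<in> G"
  shows "rename_vars \<tau> (reynolds G f) = reynolds G f"
proof -
  have inj: "inj_on (\<lambda>\<sigma>. \<tau> \<circ> \<sigma>) G"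
    by (rule inj_onI) (metis G_permutes[OF assms] fun.map_comp id_comp o_assoc permutes_inv_o(2))
  have img: "(\<lambda>\<sigma>. \<tau> \<circ> \<sigma>) ` G = G"
    using inj assms by (intro endo_inj_surj finite_G) (auto intro: G_comp)
  have "rename_vars \<tau> (reynolds G f) = (\<Sum>\<sigma>\<in>G. rename_vars (\<tau> \<circ> \<sigma>) f)"
    by (simp add: reynolds_def rename_vars_sum rename_vars_comp)
  also have "\<dots> = (\<Sum>\<sigma>\<in>(\<lambda>\<sigma>. \<tau> \<circ> \<sigma>) ` G. rename_vars \<sigma> f)"
    by (simp add: sum.reindex[OF inj])
  finally show ?thesis by (simp add: img reynolds_def)
qed

lemma invariant_class:
  assumes "f \<in> carrier (free_algebra n)" "homogeneous d f"
    and "\<And>\<sigma>. \<sigma> \<in> G \<Longrightarrow> skew_cong n (rename_vars \<sigma> f) f"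
  shows "skew_class n f \<in> invariant_component n G d"
  using assms skew_class_surj[of n]
  by (auto simp: invariant_component_def skew_component_def invariant_ring_def
      perm_act_class[OF G_permutes] skew_class_eq_iff)

lemma irrelevant_incl: "1 \<le> d \<Longrightarrow> x \<in> invariant_component n G d \<Longrightarrow>
    x \<in> irrelevant_ideal (invariant_ring n G) (invariant_component n G)"
  unfolding irrelevant_ideal_def by (intro generate.incl) auto

text \<open>\<open>ideal_prod\<close> is generated from products by sums, so 0 is obtained as the
  product 0 times 0.\<close>

lemma zero_in_square: "skew_class n 0 \<in> (decomp_square n G :: 'k::field nc_poly set set)"
proof -
  let ?z = "skew_class n (0 :: 'k nc_poly)"
  have "?z \<in> irrelevant_ideal (invariant_ring n G) (invariant_component n G)"
    by (rule irrelevant_incl[of 1]) (auto intro!: invariant_class simp: free_algebra_closed homogeneous_def)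
  then have "?z \<otimes>\<^bsub>invariant_ring n G\<^esub> ?z \<in> decomp_square n G"
    unfolding irrelevant_square_def by (intro ideal_prod.prod)
  then show ?thesis
    by (simp add: invariant_ring_simps free_algebra_closed flip: skew_class_mult)
qed

lemma decomposable_add:
  assumes "f \<in> decomposable n G" "g \<in> decomposable n G"
  shows "f + g \<in> decomposable n G"
proof -
  have "skew_class n (reynolds G (scalar c * (f + g))) \<in> decomp_square n G" for c
  proof -
    have "skew_class n (reynolds G (scalar c * f)) \<oplus>\<^bsub>invariant_ring n G\<^esub>
        skew_class n (reynolds G (scalar c * g)) \<in> decomp_square n G"
      using assms unfolding irrelevant_square_def
      by (intro ideal_prod.sum) (auto simp: decomposable_def irrelevant_square_def)
    then show ?thesis
      using assms by (simp add: distrib_left reynolds_add skew_class_add reynolds_carrier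
          free_algebra_closed scalar_carrier decomposable_def invariant_ring_simps)
  qed
  then show ?thesis using assms by (auto simp: decomposable_def free_algebra_closed)
qed

lemma decomposable_scalar: "f \<in> decomposable n G \<Longrightarrow> scalar c * f \<in> decomposable n G"
  by (auto simp: decomposable_def free_algebra_closed scalar_carrier
      simp flip: mult.assoc scalar_simps(2))

lemma decomposable_cong:
  assumes "g \<in> decomposable n G" "f \<in> carrier (free_algebra n)" "skew_cong n f g"
  shows "f \<in> decomposable n G"
proof -
  have "skew_class n (reynolds G (scalar c * f)) = skew_class n (reynolds G (scalar c * g))" for c
    unfolding skew_class_eq_iff reynolds_def
  proof (rule skew_cong_sum)
    fix \<sigma> assume \<sigma>: "\<sigma> \<in> G"
    have "rename_vars \<sigma> (f - g) \<in> skew_ideal n"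
      using rename_vars_skew_ideal_subset[OF G_permutes[OF \<sigma>]] assms(3) by (auto simp: skew_cong_def)
    moreover have "rename_vars \<sigma> (f - g) = rename_vars \<sigma> f - rename_vars \<sigma> g"
      using rename_vars_add[of \<sigma> "f - g" g] by simp
    ultimately show "skew_cong n (rename_vars \<sigma> (scalar c * f)) (rename_vars \<sigma> (scalar c * g))"
      unfolding rename_scalar by (intro skew_cong_mult_left scalar_carrier) (simp add: skew_cong_def)
  qed
  then show ?thesis using assms by (simp add: decomposable_def)
qed

lemma decomposable_zero: "0 \<in> decomposable n G"
  using zero_in_square by (simp add: decomposable_def free_algebra_closed reynolds_def)

text \<open>An invariant factor can be pulled out of the group sum: the sum for F g is F times the
  sum for g, a product of two invariants of positive degree. The factor g itself may be any
  homogeneous element.\<close>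

lemma decomposable_prod:
  assumes F: "F \<in> carrier (free_algebra n)" "homogeneous p F" "1 \<le> p"
      "\<And>\<sigma>. \<sigma> \<in> G \<Longrightarrow> skew_cong n (rename_vars \<sigma> F) F"
    and g: "g \<in> carrier (free_algebra n)" "homogeneous q g" "1 \<le> q"
  shows "F * g \<in> decomposable n G"
proof -
  have "skew_class n (reynolds G (scalar c * (F * g))) \<in> decomp_square n G" for c
  proof -
    let ?g = "scalar c * g"
    have g': "?g \<in> carrier (free_algebra n)" "homogeneous q ?g"
      using g by (auto intro: free_algebra_closed scalar_carrier homogeneous_scalar_mult)
    have "scalar c * (F * g) = F * ?g"
      by (metis mult.assoc scalar_commute)
    then have "reynolds G (scalar c * (F * g)) = (\<Sum>\<sigma>\<in>G. rename_vars \<sigma> F * rename_vars \<sigma> ?g)"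
      by (simp add: reynolds_def rename_vars_mult)
    also have "skew_cong n \<dots> (\<Sum>\<sigma>\<in>G. F * rename_vars \<sigma> ?g)"
      using F g' by (intro skew_cong_sum skew_cong_mult_right rename_carrier)
    also have "\<dots> = F * reynolds G ?g" by (simp add: reynolds_def sum_distrib_left)
    finally have "skew_class n (reynolds G (scalar c * (F * g))) =
        skew_class n F \<otimes>\<^bsub>invariant_ring n G\<^esub> skew_class n (reynolds G ?g)"
      using F(1) g'(1)
      by (simp only: skew_class_eq_iff[symmetric] skew_class_mult reynolds_carrier invariant_ring_simps)
    moreover have "skew_class n (reynolds G ?g) \<in> invariant_component n G q"
    proof (rule invariant_class)
      show "homogeneous q (reynolds G ?g)"
        unfolding reynolds_def by (intro homogeneous_sum homogeneous_rename g')
    qed (simp_all add: g' reynolds_carrier rename_reynolds)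
    moreover have "skew_class n F \<in> invariant_component n G p"
      using F by (intro invariant_class)
    ultimately show ?thesis
      unfolding irrelevant_square_def
      by (simp only:) (intro ideal_prod.prod irrelevant_incl[OF F(3)] irrelevant_incl[OF g(3)])
  qed
  then show ?thesis using F(1) g(1) by (auto simp: decomposable_def free_algebra_closed)
qed

lemma decomposable_uminus: "f \<in> decomposable n G \<Longrightarrow> - f \<in> decomposable n G"
  using decomposable_scalar[of f "-1"] by (simp add: scalar_simps)

lemma decomposable_divide:
  fixes f :: "'k::field nc_poly"
  assumes "of_nat m * f \<in> decomposable n G" "(of_nat m :: 'k) \<noteq> 0"
  shows "f \<in> decomposable n G"
proof -
  have "scalar (inverse (of_nat m)) * (scalar (of_nat m) * f) = f"
    unfolding mult.assoc[symmetric] scalar_simps(2)[symmetric] using assms(2) by (simp add: scalar_simps)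
  then show ?thesis
    using decomposable_scalar[OF assms(1), of "inverse (of_nat m)"] by (simp add: scalar_of_nat)
qed

lemma decomposable_sum: "(\<And>j. j \<in> J \<Longrightarrow> f j \<in> decomposable n G) \<Longrightarrow> sum f J \<in> decomposable n G"
  by (induction J rule: infinite_finite_induct) (auto intro: decomposable_add decomposable_zero)

lemma monomial_span: "monomial_span n (mono_poly n) (decomposable n G)"
  by unfold_locales
    (auto intro: mono_poly_cong decomposable_zero decomposable_add decomposable_uminus)

text \<open>Expands the product of an invariant sum of monomials with x^b into sorted monomials; the
  signs are those of \<open>mono_poly_mult\<close>.\<close>

lemma mono_poly_prod_mem:
  fixes c :: "'j \<Rightarrow> nat \<Rightarrow> nat"
  assumes J: "\<And>j. j \<in> J \<Longrightarrow> total_degree n (c j) = p" "1 \<le> p" "1 \<le> total_degree n b"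
    and inv: "\<And>\<sigma>. \<sigma> \<in> G \<Longrightarrow> skew_cong n (rename_vars \<sigma> (\<Sum>j\<in>J. mono_poly n (c j)))
      (\<Sum>j\<in>J. mono_poly n (c j) :: 'k::field nc_poly)"
  shows "(\<Sum>j\<in>J. (-1) ^ (\<Sum>x\<in>{1..n}. c j x * (\<Sum>i\<in>{1..<x}. b i)) * mono_poly n (\<lambda>i. b i + c j i))
    \<in> (decomposable n G :: 'k nc_poly set)"
proof (rule decomposable_cong)
  let ?F = "\<Sum>j\<in>J. mono_poly n (c j) :: 'k nc_poly"
  have "homogeneous p ?F"
  proof (rule homogeneous_sum)
    fix j assume "j \<in> J"
    then show "homogeneous p (mono_poly n (c j) :: 'k nc_poly)"
      using homogeneous_mono[of n "c j", where 'a = 'k] J(1)[of j] by simp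
  qed
  then show "?F * mono_poly n b \<in> decomposable n G"
    using J inv by (intro decomposable_prod[of _ p _ "total_degree n b"] free_algebra_sum mono_poly_carrier homogeneous_mono)
  show "(\<Sum>j\<in>J. (-1) ^ (\<Sum>x\<in>{1..n}. c j x * (\<Sum>i\<in>{1..<x}. b i)) * mono_poly n (\<lambda>i. b i + c j i))
      \<in> carrier (free_algebra n)"
    by (intro free_algebra_sum free_algebra_closed sign_carrier mono_poly_carrier)
  show "skew_cong n (\<Sum>j\<in>J. (-1) ^ (\<Sum>x\<in>{1..n}. c j x * (\<Sum>i\<in>{1..<x}. b i)) *
      mono_poly n (\<lambda>i. b i + c j i)) (?F * mono_poly n b)"
    unfolding sum_distrib_right by (intro skew_cong_sum skew_cong_sym[OF mono_poly_mult])
qed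

end

section \<open>Invariance of the sums e_k and E_k\<close>

lemma ind_image:
  assumes "\<sigma> permutes {1..n}"
  shows "ind (\<sigma> ` S) i = ind S (inv_into UNIV \<sigma> i)"
proof -
  have "i \<in> \<sigma> ` S \<longleftrightarrow> inv_into UNIV \<sigma> i \<in> S"
    using permutes_inverses[OF assms] by (metis image_iff)
  then show ?thesis by simp
qed

lemma permutes_image_subset:
  assumes "\<sigma> permutes {1..n}" "S \<subseteq> {1..n}"
  shows "\<sigma> ` S \<subseteq> {1..n}" "card (\<sigma> ` S) = card S"
  using permutes_image[OF assms(1)] assms(2) card_image[OF permutes_inj_on[OF assms(1)], of S] by auto

lemma bij_betw_subsets:
  assumes \<sigma>: "\<sigma> permutes {1..n}"
  shows "bij_betw ((`) \<sigma>) {S. S \<subseteq> {1..n} \<and> card S = k} {S. S \<subseteq> {1..n} \<and> card S = k}"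
proof (rule bij_betw_byWitness[where f' = "(`) (inv_into UNIV \<sigma>)"])
  note \<sigma>' = permutes_inv[OF \<sigma>]
  show "(`) \<sigma> ` {S. S \<subseteq> {1..n} \<and> card S = k} \<subseteq> {S. S \<subseteq> {1..n} \<and> card S = k}"
    using permutes_image_subset[OF \<sigma>] by blast
  show "(`) (inv_into UNIV \<sigma>) ` {S. S \<subseteq> {1..n} \<and> card S = k} \<subseteq> {S. S \<subseteq> {1..n} \<and> card S = k}"
    using permutes_image_subset[OF \<sigma>'] by blast
qed (simp_all add: image_comp permutes_inv_o[OF \<sigma>])

lemma bij_betw_flags:
  assumes \<sigma>: "\<sigma> permutes {1..n}"
  shows "bij_betw (\<lambda>(S, s). (\<sigma> ` S, \<sigma> s)) (flags n k) (flags n k)"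
proof (rule bij_betw_byWitness[where f' = "\<lambda>(S, s). (inv_into UNIV \<sigma> ` S, inv_into UNIV \<sigma> s)"])
  have map: "(\<lambda>(S, s). (\<tau> ` S, \<tau> s)) ` flags n k \<subseteq> flags n k" if \<tau>: "\<tau> permutes {1..n}" for \<tau>
  proof clarify
    fix S s assume "(S, s) \<in> flags n k"
    then have S: "S \<subseteq> {1..n}" "card S = k" "s \<in> {1..n}" "s \<notin> S" by (simp_all add: mem_flags)
    have "\<tau> s \<notin> \<tau> ` S"
      using S(4) permutes_inj[OF \<tau>] by (simp add: inj_image_mem_iff)
    then show "(\<tau> ` S, \<tau> s) \<in> flags n k"
      unfolding mem_flags using permutes_image_subset[OF \<tau> S(1)] S permutes_in_image[OF \<tau>] by blast
  qed
  show "(\<lambda>(S, s). (\<sigma> ` S, \<sigma> s)) ` flags n k \<subseteq> flags n k"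
    "(\<lambda>(S, s). (inv_into UNIV \<sigma> ` S, inv_into UNIV \<sigma> s)) ` flags n k \<subseteq> flags n k"
    using map[OF \<sigma>] map[OF permutes_inv[OF \<sigma>]] .
qed (auto simp: image_comp permutes_inv_o[OF \<sigma>] permutes_inverses[OF \<sigma>])

lemma rename_elementary:
  assumes \<sigma>: "\<sigma> permutes {1..n}" and "even r \<or> (-1 :: 'k::field nc_poly) = 1"
  shows "skew_cong n (rename_vars \<sigma> (\<Sum>S | S \<subseteq> {1..n} \<and> card S = k. mono_poly n (\<lambda>i. r * ind S i)))
    (\<Sum>S | S \<subseteq> {1..n} \<and> card S = k. mono_poly n (\<lambda>i. r * ind S i) :: 'k nc_poly)"
proof -
  let ?J = "{S. S \<subseteq> {1..n} \<and> card S = k}"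
  have "skew_cong n (\<Sum>S\<in>?J. rename_vars \<sigma> (mono_poly n (\<lambda>i. r * ind S i)))
      (\<Sum>S\<in>?J. mono_poly n ((\<lambda>i. r * ind S i) \<circ> inv_into UNIV \<sigma>) :: 'k nc_poly)"
    using assms(2) by (intro skew_cong_sum rename_mono_poly \<sigma>) auto
  also have "(\<Sum>S\<in>?J. mono_poly n ((\<lambda>i. r * ind S i) \<circ> inv_into UNIV \<sigma>)) =
      (\<Sum>S\<in>?J. mono_poly n (\<lambda>i. r * ind (\<sigma> ` S) i) :: 'k nc_poly)"
    unfolding ind_image[OF \<sigma>] o_def ..
  also have "(\<Sum>S\<in>?J. mono_poly n (\<lambda>i. r * ind (\<sigma> ` S) i)) =
      (\<Sum>S\<in>?J. mono_poly n (\<lambda>i. r * ind S i) :: 'k nc_poly)"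
    by (rule sum.reindex_bij_betw[OF bij_betw_subsets[OF \<sigma>],
          of "\<lambda>S. mono_poly n (\<lambda>i. r * ind S i) :: 'k nc_poly"])
  finally show ?thesis by (simp add: rename_vars_sum)
qed

lemma rename_flag_sum:
  assumes \<sigma>: "\<sigma> permutes {1..n}"
  shows "skew_cong n (rename_vars \<sigma> (\<Sum>(S, s)\<in>flags n k. mono_poly n (odd_vec S s)))
    (\<Sum>(S, s)\<in>flags n k. mono_poly n (odd_vec S s) :: 'k::field nc_poly)"
proof -
  have "skew_cong n (\<Sum>x\<in>flags n k. rename_vars \<sigma> (mono_poly n (odd_vec (fst x) (snd x))))
      (\<Sum>x\<in>flags n k. mono_poly n (odd_vec (fst x) (snd x) \<circ> inv_into UNIV \<sigma>) :: 'k nc_poly)"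
    by (intro skew_cong_sum rename_mono_poly \<sigma>) (auto simp: odd_vec_def)
  also have "(\<Sum>x\<in>flags n k. mono_poly n (odd_vec (fst x) (snd x) \<circ> inv_into UNIV \<sigma>)) =
      (\<Sum>x\<in>flags n k. mono_poly n (odd_vec (\<sigma> ` fst x) (\<sigma> (snd x))) :: 'k nc_poly)"
  proof -
    have "ind {\<sigma> s} i = ind {s} (inv_into UNIV \<sigma> i)" for s i
      using ind_image[OF \<sigma>, where S = "{s}" and i = i] by simp
    then have "odd_vec (\<sigma> ` S) (\<sigma> s) = odd_vec S s \<circ> inv_into UNIV \<sigma>" for S s
      unfolding fun_eq_iff o_apply odd_vec_def ind_image[OF \<sigma>] by simp
    then show ?thesis by (simp only:)
  qed
  also have "(\<Sum>x\<in>flags n k. mono_poly n (odd_vec (\<sigma> ` fst x) (\<sigma> (snd x)))) =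
      (\<Sum>(S, s)\<in>flags n k. mono_poly n (odd_vec S s) :: 'k nc_poly)"
    using sum.reindex_bij_betw[OF bij_betw_flags[OF \<sigma>, of k],
        of "\<lambda>(S, s). mono_poly n (odd_vec S s) :: 'k nc_poly"]
    by (simp add: case_prod_unfold)
  finally show ?thesis by (simp add: rename_vars_sum case_prod_unfold)
qed

context perm_group
begin

lemma skew_monomial_span:
  "skew_monomial_span n (mono_poly n) (decomposable n G :: 'k::field nc_poly set)"
proof -
  interpret monomial_span n "mono_poly n" "decomposable n G :: 'k nc_poly set"
    by (rule monomial_span)
  show ?thesis
  proof
    fix k :: nat and b :: "nat \<Rightarrow> nat" assume k: "1 \<le> k" and b: "1 \<le> total_degree n b"
    let ?J = "{S. S \<subseteq> {1..n} \<and> card S = k}"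
    have "(\<Sum>S\<in>?J. (-1) ^ (\<Sum>x\<in>{1..n}. (2 * ind S x) * (\<Sum>i\<in>{1..<x}. b i)) *
        mono_poly n (\<lambda>i. b i + 2 * ind S i)) \<in> (decomposable n G :: 'k nc_poly set)"
      using k b by (intro mono_poly_prod_mem[of _ _ "2 * k"] rename_elementary G_permutes)
        (auto simp: total_degree_ind simp del: One_nat_def)
    moreover have "even (\<Sum>x\<in>{1..n}. (2 * ind S x) * (\<Sum>i\<in>{1..<x}. b i))" for S
      by (intro dvd_sum) simp
    ultimately show "(\<Sum>S\<in>?J. mono_poly n (\<lambda>i. b i + 2 * ind S i)) \<in> (decomposable n G :: 'k nc_poly set)"
      by (simp only: neg_one_even_power mult_1)
  next
    fix k :: nat and b :: "nat \<Rightarrow> nat" assume b: "1 \<le> total_degree n b"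
    have "(\<Sum>x\<in>flags n k. (-1) ^ (\<Sum>i\<in>{1..n}. odd_vec (fst x) (snd x) i * (\<Sum>j\<in>{1..<i}. b j)) *
        mono_poly n (\<lambda>i. b i + odd_vec (fst x) (snd x) i)) \<in> (decomposable n G :: 'k nc_poly set)"
      using b rename_flag_sum[OF G_permutes, where 'k = 'k]
      by (intro mono_poly_prod_mem[of _ _ "2 * k + 1"]) (auto simp: total_degree_odd_vec case_prod_unfold)
    \<comment> \<open>All even exponents drop out modulo 2, and only the letter s remains.\<close>
    moreover have "(-1) ^ (\<Sum>i\<in>{1..n}. odd_vec S s i * (\<Sum>j\<in>{1..<i}. b j)) =
        ((-1) ^ (\<Sum>j\<in>{1..<s}. b j) :: 'k nc_poly)" if S: "(S, s) \<in> flags n k" for S s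
    proof -
      let ?h = "\<lambda>i. \<Sum>j\<in>{1..<i}. b j"
      have "(\<Sum>i\<in>{1..n}. odd_vec S s i * ?h i) = sum ?h S + sum ?h (insert s S)"
        using dot_odd_vec[OF S, of ?h] by (simp add: mult.commute)
      also have "\<dots> = 2 * sum ?h S + ?h s"
        using S finite_subset[of S "{1..n}"] by (simp add: mem_flags)
      finally show ?thesis by (simp add: power_add power_mult)
    qed
    ultimately show "(\<Sum>(S, s)\<in>flags n k. (-1) ^ (\<Sum>j\<in>{1..<s}. b j) *
        mono_poly n (\<lambda>i. b i + odd_vec S s i)) \<in> (decomposable n G :: 'k nc_poly set)"
      by (simp add: case_prod_unfold cong: sum.cong)
  qed
qed

text \<open>If G fixes u, then x_u is invariant of degree 1 and can be split off from every monomial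
  of degree at least 2 in which it occurs.\<close>

lemma fixed_point_mem:
  assumes u: "u \<in> {1..n}" "\<And>\<sigma>. \<sigma> \<in> G \<Longrightarrow> \<sigma> u = u" and a: "1 \<le> a u" "2 \<le> total_degree n a"
  shows "mono_poly n a \<in> (decomposable n G :: 'k::field nc_poly set)"
proof -
  interpret monomial_span n "mono_poly n" "decomposable n G :: 'k nc_poly set"
    by (rule monomial_span)
  define b where "b = (\<lambda>i. a i - ind {u} i)"
  have a_eq: "a = (\<lambda>i. b i + 1 * ind {u} i)" using a(1) by (auto simp: b_def)
  have du: "total_degree n (\<lambda>i. 1 * ind {u} i) = 1" using u(1) by (subst total_degree_ind) auto
  have "total_degree n a = total_degree n b + 1" by (subst a_eq) (simp only: total_degree_add du)
  then have "1 \<le> total_degree n b" using a(2) by simp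
  have inv: "skew_cong n (rename_vars \<sigma> (mono_poly n (\<lambda>i. 1 * ind {u} i)))
      (mono_poly n (\<lambda>i. 1 * ind {u} i) :: 'k nc_poly)" if \<sigma>: "\<sigma> \<in> G" for \<sigma>
  proof -
    have "skew_cong n (rename_vars \<sigma> (mono_poly n (\<lambda>i. 1 * ind {u} i)))
        (mono_poly n ((\<lambda>i. 1 * ind {u} i) \<circ> inv_into UNIV \<sigma>) :: 'k nc_poly)"
      by (intro rename_mono_poly G_permutes \<sigma>) auto
    also have "(\<lambda>i. 1 * ind {u} i) \<circ> inv_into UNIV \<sigma> = (\<lambda>i. 1 * ind {u} i)"
      using ind_image[OF G_permutes[OF \<sigma>], where S = "{u}"] u(2)[OF \<sigma>] by (simp add: fun_eq_iff)
    finally show ?thesis .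
  qed
  have "(\<Sum>j\<in>{u}. (-1) ^ (\<Sum>x\<in>{1..n}. 1 * ind {j} x * (\<Sum>i\<in>{1..<x}. b i)) *
      mono_poly n (\<lambda>i. b i + 1 * ind {j} i)) \<in> (decomposable n G :: 'k nc_poly set)"
    using \<open>1 \<le> total_degree n b\<close> inv du by (intro mono_poly_prod_mem[of _ _ 1]) (simp_all only: sum.insert sum.empty finite.emptyI, auto)
  then have "(-1) ^ (\<Sum>x\<in>{1..n}. 1 * ind {u} x * (\<Sum>i\<in>{1..<x}. b i)) * mono_poly n a
      \<in> (decomposable n G :: 'k nc_poly set)"
    by (simp only: sum.insert sum.empty finite.emptyI add_0_right a_eq[symmetric] empty_iff
        not_False_eq_True)
  then show ?thesis unfolding sign_mem_iff .
qed

end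

section \<open>Decomposability above the bound\<close>

context perm_group
begin

text \<open>The order divides 6 and is prime to 3, hence is 1 or 2, and an involution of three
  points has a fixed point.\<close>

lemma fixed_point_3:
  assumes n: "n = 3" and "\<not> 3 dvd card G"
  obtains u where "u \<in> {1..n}" "\<And>\<sigma>. \<sigma> \<in> G \<Longrightarrow> \<sigma> u = u"
proof -
  have "card (rcosets\<^bsub>sym_group n\<^esub> G) * card G = order (sym_group n)"
    by (rule group.lagrange[OF sym_group_is_group subgroup])
  also have "\<dots> = fact 3"
    using card_permutations[of "{1..n}" n] n by (simp add: order_def sym_group_def)
  also have "fact 3 = (6 :: nat)" by (simp add: fact_numeral)
  finally have "card G dvd 6" by (metis dvd_triv_right)
  then have "card G \<le> 6" by (intro dvd_imp_le) auto
  moreover have "card G \<noteq> 0" "card G \<noteq> 3" "card G \<noteq> 4" "card G \<noteq> 5" "card G \<noteq> 6"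
    using assms(2) \<open>card G dvd 6\<close> finite_G id_in_G by auto
  ultimately have card: "card G \<le> 2" by linarith
  show thesis
  proof (cases "G = {id}")
    case True
    then show ?thesis using that[of 1] n by auto
  next
    case False
    then obtain \<sigma> where \<sigma>: "\<sigma> \<in> G" "\<sigma> \<noteq> id" using id_in_G by blast
    have G: "G = {id, \<sigma>}"
      using card \<sigma> id_in_G by (intro card_seteq[symmetric] finite_G) auto
    have "\<sigma> \<circ> \<sigma> \<noteq> \<sigma>"
      using \<sigma>(2) permutes_inv_o(2)[OF G_permutes[OF \<sigma>(1)]] by (metis comp_assoc id_comp)
    then have inv: "\<sigma> \<circ> \<sigma> = id" using G_comp[OF \<sigma>(1) \<sigma>(1)] G by blast
    have ivl: "{1..n} = {1, 2, 3}" using n by auto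
    have "\<exists>u\<in>{1..n}. \<sigma> u = u"
    proof (rule ccontr)
      assume "\<not> (\<exists>u\<in>{1..n}. \<sigma> u = u)"
      then have ne: "\<sigma> 1 \<noteq> 1" "\<sigma> 2 \<noteq> 2" "\<sigma> 3 \<noteq> 3" unfolding ivl by blast+
      have val: "\<sigma> 1 \<in> {1, 2, 3}" "\<sigma> 2 \<in> {1, 2, 3}" "\<sigma> 3 \<in> {1, 2, 3}"
        using permutes_in_image[OF G_permutes[OF \<sigma>(1)]] unfolding ivl by blast+
      have "\<sigma> (\<sigma> x) = x" for x using inv by (metis comp_apply id_apply)
      from this[of 1] this[of 2] this[of 3] ne val show False by auto
    qed
    then obtain u where u: "u \<in> {1..n}" "\<sigma> u = u" by blast
    show ?thesis
    proof (rule that[OF u(1)])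
      fix \<tau> assume "\<tau> \<in> G"
      then show "\<tau> u = u" using G u(2) by auto
    qed
  qed
qed

lemma large_mono_poly_mem:
  assumes "2 \<le> n" "\<not> CHAR('k::field) dvd card G" "degree_bound n < total_degree n a"
  shows "mono_poly n a \<in> (decomposable n G :: 'k nc_poly set)"
proof (cases "CHAR('k) = 2")
  case True
  interpret monomial_span n "mono_poly n" "decomposable n G :: 'k nc_poly set"
    by (rule monomial_span)
  have "(of_nat 2 :: 'k) = 0" unfolding of_nat_eq_0_iff_char_dvd True by simp
  then have "(2 :: 'k nc_poly) = 0" using scalar_of_nat[of 2, where 'a = 'k] by (simp add: scalar_simps)
  then have sign: "(-1 :: 'k nc_poly) = 1" by (metis add_eq_0_iff one_add_one)
  show ?thesis
  proof (rule char2_mem[OF _ assms(1,3)])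
    fix k :: nat and b :: "nat \<Rightarrow> nat"
    assume k: "1 \<le> k" and b: "1 \<le> total_degree n b"
    have "(\<Sum>S | S \<subseteq> {1..n} \<and> card S = k. (-1) ^ (\<Sum>x\<in>{1..n}. (1 * ind S x) * (\<Sum>i\<in>{1..<x}. b i)) *
        mono_poly n (\<lambda>i. b i + 1 * ind S i)) \<in> (decomposable n G :: 'k nc_poly set)"
      using k b sign by (intro mono_poly_prod_mem[of _ _ k] rename_elementary G_permutes total_degree_ind[THEN trans]) auto
    then show "(\<Sum>S | S \<subseteq> {1..n} \<and> card S = k. mono_poly n (\<lambda>i. b i + 1 * ind S i))
        \<in> (decomposable n G :: 'k nc_poly set)"
      unfolding sign by (simp only: power_one mult_1)
  qed
next
  case False
  interpret skew_monomial_span n "mono_poly n" "decomposable n G :: 'k nc_poly set"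
    by (rule skew_monomial_span)
  have char: "(of_nat p :: 'k) \<noteq> 0" if p: "p = 2 \<or> p = 3" "CHAR('k) \<noteq> p" for p
  proof
    assume "(of_nat p :: 'k) = 0"
    then have dvd: "CHAR('k) dvd p" by (simp only: of_nat_eq_0_iff_char_dvd)
    then have "CHAR('k) \<le> p" using p(1) by (auto intro: dvd_imp_le)
    moreover have "CHAR('k) \<noteq> 0" using dvd p(1) by (metis dvd_0_left zero_neq_numeral)
    moreover have "CHAR('k) \<noteq> 1" by simp
    ultimately show False using p False by presburger
  qed
  have half: "x \<in> decomposable n G" if "x + x \<in> decomposable n G" for x :: "'k nc_poly"
  proof (rule decomposable_divide)
    show "of_nat 2 * x \<in> decomposable n G" using that by (simp add: mult_2)
    show "(of_nat 2 :: 'k) \<noteq> 0" by (rule char) (use False in auto)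
  qed
  \<comment> \<open>Outside characteristic 3 one may divide by 6. In characteristic 3 the order of G
    is prime to 3, so some variable is fixed; it occurs in these monomials since all their exponents
    are positive.\<close>
  have three: "X3 \<in> decomposable n G"
    if n: "n = 3" and X3: "X3 = mono_poly n (\<lambda>_. 2) \<or> (\<exists>a. a ` {1..3} = {1, 2, 3} \<and> X3 = mono_poly n a)"
    for X3 :: "'k nc_poly"
  proof (cases "CHAR('k) = 3")
    case True
    then obtain u where u: "u \<in> {1..n}" "\<And>\<sigma>. \<sigma> \<in> G \<Longrightarrow> \<sigma> u = u"
      using fixed_point_3 n assms(2) by metis
    have ivl: "{1..n} = {1, 2, 3}" using n by auto
    have "mono_poly n a \<in> (decomposable n G :: 'k nc_poly set)" if "\<And>i. i \<in> {1..n} \<Longrightarrow> 1 \<le> a i" for a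
    proof (rule fixed_point_mem[where u = u])
      show "u \<in> {1..n}" by (rule u(1))
      show "\<sigma> u = u" if "\<sigma> \<in> G" for \<sigma> using u(2) that .
      show "1 \<le> a u" using that u(1) .
      have "(\<Sum>i\<in>{1..n}. 1) \<le> total_degree n a" unfolding total_degree_def using that by (intro sum_mono)
      then show "2 \<le> total_degree n a" using n by simp
    qed
    moreover have "1 \<le> a i" if "a ` {1..3} = {1, 2, 3}" "i \<in> {1..n}" for a :: "nat \<Rightarrow> nat" and i
    proof -
      have "a i \<in> {1, 2, 3}" using that n by blast
      then show ?thesis by auto
    qed
    ultimately show ?thesis using X3 by auto
  next
    case False
    have third: "x \<in> decomposable n G" if "x + x + x \<in> decomposable n G" for x :: "'k nc_poly"
    proof (rule decomposable_divide)
      have "of_nat 3 = (1 + 1 + 1 :: 'k nc_poly)" by simp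
      then have "of_nat 3 * x = x + x + x" by (simp only: distrib_right mult_1)
      then show "of_nat 3 * x \<in> decomposable n G" using that by (simp only:)
      show "(of_nat 3 :: 'k) \<noteq> 0" by (rule char) (use False in auto)
    qed
    show ?thesis
      using X3
    proof (elim disjE exE conjE)
      assume "X3 = mono_poly n (\<lambda>_. 2)"
      then show ?thesis by (simp only: perm_mem_3(1)[OF half third n])
    next
      fix a assume "a ` {1..3} = {1, 2, 3}" "X3 = mono_poly n a"
      then show ?thesis by (simp only: perm_mem_3(2)[OF half third n])
    qed
  qed
  show ?thesis
  proof (rule large_degree_mem[OF half assms(1) _ _ assms(3)])
    assume "n = 2 \<or> n = 3"
    then show "mono_poly n (\<lambda>_. 2) \<in> (decomposable n G :: 'k nc_poly set)"
    proof
      assume "n = 2"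
      show ?thesis by (rule two_mem_2[OF _ \<open>n = 2\<close>]) (rule half)
    next
      assume "n = 3"
      then show ?thesis by (rule three) (rule disjI1, rule refl)
    qed
  next
    fix a :: "nat \<Rightarrow> nat" assume "n = 3" "a ` {1..3} = {1, 2, 3}"
    then show "mono_poly n a \<in> (decomposable n G :: 'k nc_poly set)"
      by (intro three disjI2 exI[of _ a] conjI refl)
  qed
qed

text \<open>Every word is a sorted monomial up to sign, so a representative of b is decomposable
  term by term. As b is invariant, averaging gives b back; here |G| has to be invertible.\<close>

lemma component_subset_square:
  assumes "2 \<le> n" "\<not> CHAR('k::field) dvd card G" "degree_bound n < d"
    and b: "b \<in> invariant_component n G d"
  shows "b \<in> (decomp_square n G :: 'k nc_poly set set)"
proof -
  obtain f where f: "f \<in> carrier (free_algebra n)" "homogeneous d f" "b = skew_class n f"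
    using b by (auto simp: invariant_component_def skew_component_def)
  have inv: "skew_cong n (rename_vars \<sigma> f) f" if "\<sigma> \<in> G" for \<sigma>
    using b that by (auto simp: invariant_component_def invariant_ring_def f(3)
        perm_act_class[OF G_permutes] skew_class_eq_iff)
  have "Poly_Mapping.single w (Poly_Mapping.lookup f w) \<in> decomposable n G"
    if w: "w \<in> Poly_Mapping.keys f" for w
  proof -
    let ?l = "letters w" and ?c = "Poly_Mapping.lookup f w"
    have l: "set ?l \<subseteq> {1..n}" "length ?l = d"
      using w f by (auto simp: free_algebra_def homogeneous_def)
    have "total_degree n (count_list ?l) = d"
      using l sum_count_set[OF l(1)] by (simp add: total_degree_def)
    then have "mono_poly n (count_list ?l) \<in> (decomposable n G :: 'k nc_poly set)"
      using assms by (intro large_mono_poly_mem) auto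
    then have "(-1) ^ inversions ?l * mono_poly n (count_list ?l) \<in> (decomposable n G :: 'k nc_poly set)"
      by (cases "even (inversions ?l)") (auto intro: decomposable_uminus)
    then have "word_poly ?l \<in> (decomposable n G :: 'k nc_poly set)"
      by (rule decomposable_cong[OF _ word_poly_carrier[OF l(1)] skew_cong_normal_form[OF l(1)]])
    then have "scalar ?c * word_poly ?l \<in> decomposable n G" by (rule decomposable_scalar)
    then show ?thesis by (simp add: scalar_def word_poly_def mult_single)
  qed
  then have dec: "f \<in> decomposable n G"
    by (subst nc_poly_sum_singles) (rule decomposable_sum)
  define m where "m = (of_nat (card G) :: 'k)"
  have m: "m \<noteq> 0" using assms(2) by (simp add: m_def of_nat_eq_0_iff_char_dvd)
  have "skew_cong n (reynolds G (scalar (inverse m) * f)) (\<Sum>\<sigma>\<in>G. scalar (inverse m) * f)"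
    unfolding reynolds_def rename_scalar
    by (intro skew_cong_sum skew_cong_mult_left scalar_carrier inv)
  also have "(\<Sum>\<sigma>\<in>G. scalar (inverse m) * f) = scalar m * (scalar (inverse m) * f)"
    by (simp add: m_def scalar_of_nat)
  also have "\<dots> = f"
    using m by (simp add: scalar_simps(3) flip: mult.assoc scalar_simps(2))
  finally have "skew_class n (reynolds G (scalar (inverse m) * f)) = b"
    by (simp add: f(3) skew_class_eq_iff)
  then show ?thesis using dec by (auto simp: decomposable_def)
qed

text \<open>Makes the arithmetic of rings available in the invariant ring, as the coset computation
  below requires.\<close>

lemma subring_invariants:
  "subring {U \<in> carrier (skew_poly_ring n). \<forall>\<sigma>\<in>G. perm_act \<sigma> U = U}
    (skew_poly_ring n :: 'k::field nc_poly set ring)"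
proof -
  let ?R = "skew_poly_ring n :: 'k nc_poly set ring"
  interpret R: ring ?R by (rule ring_skew_poly_ring)
  have hom: "ring_hom_ring ?R ?R (perm_act \<sigma>)" if "\<sigma> \<in> G" for \<sigma>
    by (intro ring_hom_ringI2 R.ring_axioms perm_act_hom G_permutes that)
  show ?thesis
  proof (rule R.subringI)
    have "perm_act \<sigma> \<one>\<^bsub>?R\<^esub> = \<one>\<^bsub>?R\<^esub>" if "\<sigma> \<in> G" for \<sigma>
      by (rule ring_hom_one[OF perm_act_hom[OF G_permutes[OF that]]])
    then show "\<one>\<^bsub>?R\<^esub> \<in> {U \<in> carrier ?R. \<forall>\<sigma>\<in>G. perm_act \<sigma> U = U}" by simp
  next
    fix U assume "U \<in> {U \<in> carrier ?R. \<forall>\<sigma>\<in>G. perm_act \<sigma> U = U}"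
    moreover have "perm_act \<sigma> (\<ominus>\<^bsub>?R\<^esub> U) = \<ominus>\<^bsub>?R\<^esub> perm_act \<sigma> U"
      if "\<sigma> \<in> G" "U \<in> carrier ?R" for \<sigma>
    proof -
      interpret h: ring_hom_ring ?R ?R "perm_act \<sigma>" using hom that(1) .
      show ?thesis by (rule h.hom_a_inv[OF that(2)])
    qed
    ultimately show "\<ominus>\<^bsub>?R\<^esub> U \<in> {U \<in> carrier ?R. \<forall>\<sigma>\<in>G. perm_act \<sigma> U = U}"
      by simp
  next
    fix U V assume UV: "U \<in> {U \<in> carrier ?R. \<forall>\<sigma>\<in>G. perm_act \<sigma> U = U}"
      "V \<in> {U \<in> carrier ?R. \<forall>\<sigma>\<in>G. perm_act \<sigma> U = U}"
    then have "perm_act \<sigma> (U \<otimes>\<^bsub>?R\<^esub> V) = perm_act \<sigma> U \<otimes>\<^bsub>?R\<^esub> perm_act \<sigma> V"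
      "perm_act \<sigma> (U \<oplus>\<^bsub>?R\<^esub> V) = perm_act \<sigma> U \<oplus>\<^bsub>?R\<^esub> perm_act \<sigma> V" if "\<sigma> \<in> G" for \<sigma>
      using ring_hom_mult[OF perm_act_hom[OF G_permutes[OF that]], of U V]
        ring_hom_add[OF perm_act_hom[OF G_permutes[OF that]], of U V] by auto
    then show "U \<otimes>\<^bsub>?R\<^esub> V \<in> {U \<in> carrier ?R. \<forall>\<sigma>\<in>G. perm_act \<sigma> U = U}"
      "U \<oplus>\<^bsub>?R\<^esub> V \<in> {U \<in> carrier ?R. \<forall>\<sigma>\<in>G. perm_act \<sigma> U = U}"
      using UV by simp_all
  qed auto
qed

text \<open>The square is closed under negation because -(ij) = (-i)j, so it is an additive group
  and absorbs its own elements.\<close>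

lemma square_coset:
  assumes b: "b \<in> (decomp_square n G :: 'k::field nc_poly set set)"
  shows "decomp_square n G +>\<^bsub>invariant_ring n G\<^esub> b = decomp_square n G"
proof -
  let ?B = "invariant_ring n G :: 'k nc_poly set ring"
  let ?I = "irrelevant_ideal ?B (invariant_component n G)"
  interpret B: ring ?B
    unfolding invariant_ring_def
    by (rule ring.subring_is_ring[OF ring_skew_poly_ring subring_invariants])
  have I: "subgroup ?I (add_monoid ?B)"
    unfolding irrelevant_ideal_def
    by (rule B.add.generate_is_subgroup) (auto simp: invariant_component_def)
  have I_carrier: "x \<in> carrier ?B" if "x \<in> ?I" for x
    using subgroup.mem_carrier[OF I that] by simp
  have sq_carrier: "x \<in> carrier ?B" if "x \<in> decomp_square n G" for x
    using that unfolding irrelevant_square_def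
    by (induction rule: ideal_prod.induct) (auto intro: I_carrier)
  have neg: "\<ominus>\<^bsub>?B\<^esub> x \<in> decomp_square n G" if "x \<in> decomp_square n G" for x
    using that unfolding irrelevant_square_def
  proof (induction rule: ideal_prod.induct)
    case (prod i j)
    have "\<ominus>\<^bsub>?B\<^esub> i \<in> ?I"
      using subgroup.m_inv_closed[OF I prod(1)] by (simp add: a_inv_def)
    then show ?case
      using prod ideal_prod.prod[of "\<ominus>\<^bsub>?B\<^esub> i" ?I j ?I ?B] by (simp add: B.l_minus I_carrier)
  next
    case (sum x y)
    then show ?case
      using ideal_prod.sum[OF sum(3,4)] sq_carrier
      by (simp add: B.minus_add irrelevant_square_def)
  qed
  have add: "x \<oplus>\<^bsub>?B\<^esub> y \<in> decomp_square n G"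
    if "x \<in> decomp_square n G" "y \<in> decomp_square n G" for x y
    using that unfolding irrelevant_square_def by (rule ideal_prod.sum)
  show ?thesis
    unfolding a_r_coset_def'
  proof (intro equalityI subsetI)
    fix x assume x: "x \<in> (decomp_square n G :: 'k nc_poly set set)"
    have "x = (x \<oplus>\<^bsub>?B\<^esub> \<ominus>\<^bsub>?B\<^esub> b) \<oplus>\<^bsub>?B\<^esub> b"
      using x b sq_carrier by (simp add: B.a_assoc B.l_neg)
    then show "x \<in> (\<Union>h\<in>decomp_square n G. {h \<oplus>\<^bsub>?B\<^esub> b})"
      using add[OF x neg[OF b]] by blast
  qed (use add b in blast)
qed

end

text \<open>For n = 1 the formula gives 0, whereas k[x_1] needs a generator of degree 1.\<close>

theorem theorem2p5:
  fixes n :: nat and G :: "(nat \<Rightarrow> nat) set"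
  assumes "n \<ge> 2"
    and "subgroup G (sym_group n)"
    and "\<not> CHAR('k::field) dvd card G"
  shows "max_generator_degree (invariant_ring n G :: 'k nc_poly set ring) (invariant_component n G)
           \<le> enat (n * (n - 1) div 2 + (n div 2) * (n div 2 + 1))
         \<and> (\<lambda>m::nat. real (m * (m - 1) div 2 + (m div 2) * (m div 2 + 1)))
             \<sim>[at_top] (\<lambda>m. 3 / 4 * real m ^ 2)"
proof (rule conjI[OF _ degree_bound_asymp])
  interpret perm_group n G by (rule perm_group.intro[OF assms(2)])
  let ?B = "invariant_ring n G :: 'k nc_poly set ring"
  have "indecomposables ?B (invariant_component n G) d = {decomp_square n G}" if d: "degree_bound n < d" for d
  proof -
    \<comment> \<open>The component is nonempty, so the set of cosets is exactly the singleton of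
      the zero coset and not empty.\<close>
    have "skew_class n 0 \<in> (invariant_component n G d :: 'k nc_poly set set)"
      by (rule invariant_class) (auto simp: free_algebra_closed homogeneous_def)
    moreover have "decomp_square n G +>\<^bsub>?B\<^esub> b = decomp_square n G"
      if "b \<in> invariant_component n G d" for b
      by (intro square_coset component_subset_square[OF assms(1,3) d] that)
    ultimately show ?thesis unfolding indecomposables_def by (auto simp: image_iff)
  qed
  then show "max_generator_degree ?B (invariant_component n G) \<le> enat (degree_bound n)"
    unfolding max_generator_degree_def by (intro Sup_least) (auto simp: not_less[symmetric])
qed

end
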